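(* Let $d\ge 1$ be an integer. For any integer $k \geq 1$ and any real $\lambda > 0$, the random variable $\widetilde{F}_{k,\lambda}(t)$ converges to $a_{k,\lambda}$ in probability as $t \to \infty$.
   Context: For $V \subseteq \mathbb{R}^d$ and $r>0$, $G_r(V)$ is the graph with vertex set $V$ in which two distinct points $u,v\in V$ are adjacent if and only if $\|u-v\|\le r$ (Euclidean norm). For $k \in \mathbb{N}=\{1,2,\dots\}$ and finite $V$, $N_{k,r}(V)$ is the maximum number of vertices of $G_r(V)$ that can be properly colored with $k$ colors, i.e., the largest cardinality of a subset $U\subseteq V$ such that the induced subgraph $G_r(U)$ is $k$-colorable. $\mathcal{X}_\lambda$ is a Poisson point process of (constant) intensity $\lambda$ in $\mathbb{R}^d$. Set $F_{k,\lambda}(t) = N_{k,1}([0,t]^d \cap \mathcal{X}_\lambda)$, $\widetilde{F}_{k,\lambda}(t) = F_{k,\lambda}(t)/(\lambda t^d)$ and $\overline{F}_{k,\lambda}(t) = \mathbb{E}\{\widetilde{F}_{k,\lambda}(t)\}$ for $t>0$. The constant is $a_{k,\lambda} = \inf_{t>0}\overline{F}_{k,\lambda}(t)$, which also equals $\lim_{t\to\infty}\overline{F}_{k,\lambda}(t)$. *)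

theory Defs
  imports "HOL-Probability.Probability"
begin

type_synonym 'a graph = "'a set \<times> ('a \<times> 'a) set"

definition geometric_graph :: "real \<Rightarrow> (real ^ 'd) set \<Rightarrow> (real ^ 'd) graph" where
  "geometric_graph r V = (V, {(u, v). u \<in> V \<and> v \<in> V \<and> u \<noteq> v \<and> norm (u - v) \<le> r})"

definition colorable :: "nat \<Rightarrow> 'a graph \<Rightarrow> bool" where
  "colorable k G \<longleftrightarrow>
     (\<exists>c :: 'a \<Rightarrow> nat. (\<forall>v \<in> fst G. c v \<in> {1..k}) \<and> (\<forall>(u, v) \<in> snd G. c u \<noteq> c v))"

(* Meaningful for finite V only: Max is unspecified on infinite sets. *)
definition max_colorable :: "nat \<Rightarrow> real \<Rightarrow> (real ^ 'd) set \<Rightarrow> nat" where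
  "max_colorable k r V = Max {card U | U. U \<subseteq> V \<and> colorable k (geometric_graph r U)}"

(* A Poisson process is given as a random locally finite set of points, so the number of points
   in a bounded set is a natural number at every outcome and card never takes its default value.
   The Poisson weights are written out because poisson_pmf is unspecified at rate 0, which occurs
   for null sets B. *)
locale poisson_point_process = prob_space M
  for M :: "'w measure" +
  fixes lam :: real and X :: "'w \<Rightarrow> (real ^ 'd) set"
  assumes locally_finite: "\<And>w B. w \<in> space M \<Longrightarrow> bounded B \<Longrightarrow> finite (X w \<inter> B)"
    and measurable_count: "\<And>B. B \<in> sets borel \<Longrightarrow> bounded B \<Longrightarrow>
      (\<lambda>w. card (X w \<inter> B)) \<in> measurable M (count_space UNIV)"
    and prob_count: "\<And>B n. B \<in> sets borel \<Longrightarrow> bounded B \<Longrightarrow>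
      prob {w \<in> space M. card (X w \<inter> B) = n} =
        (lam * measure lborel B) ^ n / fact n * exp (- (lam * measure lborel B))"
    and indep_counts: "\<And>(B :: nat \<Rightarrow> (real ^ 'd) set) n.
      (\<And>i. i < n \<Longrightarrow> B i \<in> sets borel \<and> bounded (B i)) \<Longrightarrow> disjoint_family_on B {..<n} \<Longrightarrow>
      indep_vars (\<lambda>_. count_space UNIV) (\<lambda>i w. card (X w \<inter> B i)) {..<n}"

definition cube :: "real \<Rightarrow> (real ^ 'd) set" where
  "cube t = {x. \<forall>i. x $ i \<in> {0..t}}"

definition F_count :: "nat \<Rightarrow> ('w \<Rightarrow> (real ^ 'd) set) \<Rightarrow> real \<Rightarrow> 'w \<Rightarrow> nat" where
  "F_count k X t w = max_colorable k 1 (cube t \<inter> X w)"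

definition F_tilde :: "nat \<Rightarrow> real \<Rightarrow> ('w \<Rightarrow> (real ^ 'd) set) \<Rightarrow> real \<Rightarrow> 'w \<Rightarrow> real" where
  "F_tilde k lam X t w = real (F_count k X t w) / (lam * t ^ CARD('d))"

definition F_bar :: "'w measure \<Rightarrow> nat \<Rightarrow> real \<Rightarrow> ('w \<Rightarrow> (real ^ 'd) set) \<Rightarrow> real \<Rightarrow> real" where
  "F_bar M k lam X t = prob_space.expectation M (F_tilde k lam X t)"

(* Determined by k, lam and the dimension alone, since the law of X is. *)
definition a_const :: "'w measure \<Rightarrow> nat \<Rightarrow> real \<Rightarrow> ('w \<Rightarrow> (real ^ 'd) set) \<Rightarrow> real" where
  "a_const M k lam X = (INF t \<in> {0<..}. F_bar M k lam X t)"

(* Measurability is part of the notion: otherwise measure, which is 0 on non-measurable sets,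
   could make the limit hold vacuously. *)
definition converges_in_prob_at_top :: "'w measure \<Rightarrow> (real \<Rightarrow> 'w \<Rightarrow> real) \<Rightarrow> real \<Rightarrow> bool" where
  "converges_in_prob_at_top M Y c \<longleftrightarrow>
     (\<forall>t > 0. Y t \<in> borel_measurable M) \<and>
     (\<forall>\<epsilon> > 0. ((\<lambda>t. measure M {w \<in> space M. \<bar>Y t w - c\<bar> > \<epsilon>}) \<longlongrightarrow> 0) at_top)"

end

(* Properly k-colourable subsets restrict to subsets, so the count is subadditive over
   a tiling of [0,t]^d by cells of side s. The cell counts are identically distributed and
   uncorrelated, so the average of these bounds concentrates around its mean, which is at most the
   normalised mean on [0,s]^d; hence the positive part of F_tilde - a tends to 0 in L1. Since the
   mean of F_tilde is never below a, the negative part tends to 0 in L1 as well, and no separate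
   concentration inequality for the count itself is needed.

   The law of the process is only given through counts. Rounding the points to a grid of mesh
   delta while slightly enlarging the adjacency radius leaves the maximum unchanged once delta is
   small (depending on the configuration), and the rounded configuration is a function of the
   finite set of occupied grid cells. Stationarity and decorrelation of the cell counts thus reduce
   to the explicit law of that set. *)
theory Submission
  imports Defs
begin

section \<open>Colorable subsets of geometric graphs\<close>

lemma colorable_geometric_iff:
  "colorable k (geometric_graph r U) \<longleftrightarrow>
     (\<exists>c. (\<forall>v\<in>U. c v \<in> {1..k}) \<and> (\<forall>u\<in>U. \<forall>v\<in>U. u \<noteq> v \<longrightarrow> norm (u - v) \<le> r \<longrightarrow> c u \<noteq> c v))"
  unfolding colorable_def geometric_graph_def by (rule arg_cong[where f = Ex]) (auto intro!: ext)

lemma colorable_geometric_subset: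
  assumes "colorable k (geometric_graph r U)" "W \<subseteq> U"
  shows "colorable k (geometric_graph r W)"
proof -
  obtain c where "\<forall>v\<in>U. c v \<in> {1..k}" "\<forall>u\<in>U. \<forall>v\<in>U. u \<noteq> v \<longrightarrow> norm (u - v) \<le> r \<longrightarrow> c u \<noteq> c v"
    using assms(1) unfolding colorable_geometric_iff by blast
  then have "(\<forall>v\<in>W. c v \<in> {1..k}) \<and> (\<forall>u\<in>W. \<forall>v\<in>W. u \<noteq> v \<longrightarrow> norm (u - v) \<le> r \<longrightarrow> c u \<noteq> c v)"
    using assms(2) by (meson subsetD)
  then show ?thesis
    unfolding colorable_geometric_iff by blast
qed

text \<open>A colouring of \<open>U\<close> is carried along the inverse of \<open>\<phi>\<close>:
  every edge of the image comes from an edge of \<open>U\<close>, so no new conflict arises.\<close>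

lemma colorable_geometric_image:
  assumes col: "colorable k (geometric_graph r U)" and inj: "inj_on \<phi> U"
    and adj: "\<And>u v. u \<in> U \<Longrightarrow> v \<in> U \<Longrightarrow> norm (\<phi> u - \<phi> v) \<le> r' \<Longrightarrow> norm (u - v) \<le> r"
  shows "colorable k (geometric_graph r' (\<phi> ` U))"
proof -
  obtain c where "\<forall>v\<in>U. c v \<in> {1..k}" "\<forall>u\<in>U. \<forall>v\<in>U. u \<noteq> v \<longrightarrow> norm (u - v) \<le> r \<longrightarrow> c u \<noteq> c v"
    using col unfolding colorable_geometric_iff by blast
  then have "(\<forall>v\<in>\<phi> ` U. (c \<circ> inv_into U \<phi>) v \<in> {1..k}) \<and>
      (\<forall>u\<in>\<phi> ` U. \<forall>v\<in>\<phi> ` U. u \<noteq> v \<longrightarrow> norm (u - v) \<le> r' \<longrightarrow>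
        (c \<circ> inv_into U \<phi>) u \<noteq> (c \<circ> inv_into U \<phi>) v)"
    using adj inj by (auto simp: inv_into_f_f) metis
  then show ?thesis
    unfolding colorable_geometric_iff by blast
qed

section \<open>The largest colourable subset: attainment, subadditivity, invariance\<close>

lemma finite_colorable_cards:
  assumes "finite V"
  shows "finite {card U | U. U \<subseteq> V \<and> colorable k (geometric_graph r U)}"
  by (rule finite_subset[of _ "card ` Pow V"]) (use assms in auto)

lemma card_le_max_colorable:
  assumes "finite V" "U \<subseteq> V" "colorable k (geometric_graph r U)"
  shows "card U \<le> max_colorable k r V"
  unfolding max_colorable_def
  by (intro Max_ge finite_colorable_cards) (use assms in auto)

lemma max_colorable_witness:
  assumes "finite V"
  obtains U where "U \<subseteq> V" "colorable k (geometric_graph r U)" "card U = max_colorable k r V"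
proof -
  \<comment> \<open>The empty set is colourable for every \<open>k\<close>, so \<open>Max\<close>
    ranges over a non-empty set.\<close>
  have "colorable k (geometric_graph r {})"
    unfolding colorable_geometric_iff by auto
  then have "{card U | U. U \<subseteq> V \<and> colorable k (geometric_graph r U)} \<noteq> {}"
    by auto
  from Max_in[OF finite_colorable_cards[OF assms] this] show ?thesis
    using that unfolding max_colorable_def by auto
qed

lemma max_colorable_le_card:
  assumes "finite V"
  shows "max_colorable k r V \<le> card V"
proof -
  obtain U where "U \<subseteq> V" "card U = max_colorable k r V"
    using max_colorable_witness[OF assms] by metis
  then show ?thesis
    using card_mono[OF assms] by metis
qed

lemma max_colorable_mono:
  assumes "finite W" "V \<subseteq> W"
  shows "max_colorable k r V \<le> max_colorable k r W"
proof -
  obtain U where "U \<subseteq> V" "colorable k (geometric_graph r U)" "card U = max_colorable k r V"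
    using max_colorable_witness finite_subset[OF assms(2,1)] by metis
  then show ?thesis
    using card_le_max_colorable[OF assms(1)] assms(2) by (metis subset_trans)
qed

text \<open>A maximiser for the union is cut into its parts in \<open>V\<close> and in
  \<open>W\<close>; colourability passes to subsets.\<close>

lemma max_colorable_Un_le:
  assumes "finite V" "finite W"
  shows "max_colorable k r (V \<union> W) \<le> max_colorable k r V + max_colorable k r W"
proof -
  obtain U where U: "U \<subseteq> V \<union> W" "colorable k (geometric_graph r U)"
    "card U = max_colorable k r (V \<union> W)"
    using max_colorable_witness assms by (metis finite_Un)
  have "card U = card ((U \<inter> V) \<union> (U \<inter> W))"
    using U(1) by (intro arg_cong[where f = card]) auto
  also have "\<dots> \<le> card (U \<inter> V) + card (U \<inter> W)"
    by (rule card_Un_le)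
  also have "\<dots> \<le> max_colorable k r V + max_colorable k r W"
    by (intro add_mono card_le_max_colorable assms colorable_geometric_subset[OF U(2)]) auto
  finally show ?thesis
    using U(3) by simp
qed

lemma max_colorable_UN_le:
  assumes "finite Z" "\<And>z. z \<in> Z \<Longrightarrow> finite (V z)"
  shows "max_colorable k r (\<Union>z\<in>Z. V z) \<le> (\<Sum>z\<in>Z. max_colorable k r (V z))"
  using assms
proof (induction Z rule: finite_induct)
  case empty
  then show ?case
    using max_colorable_le_card[of "{}" k r] by simp
next
  case (insert z Z)
  have "max_colorable k r (\<Union>z\<in>insert z Z. V z)
      \<le> max_colorable k r (V z) + max_colorable k r (\<Union>z\<in>Z. V z)"
    using insert by (simp add: max_colorable_Un_le)
  then show ?case
    using insert by fastforce
qed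

text \<open>A maximiser is carried forward by \<open>\<phi>\<close> for one inequality and back by
  its inverse for the other. The two radii may differ, as the rounding to a grid requires.\<close>

lemma max_colorable_image:
  assumes fin: "finite V" and inj: "inj_on \<phi> V"
    and adj: "\<And>u v. u \<in> V \<Longrightarrow> v \<in> V \<Longrightarrow> norm (\<phi> u - \<phi> v) \<le> r' \<longleftrightarrow> norm (u - v) \<le> r"
  shows "max_colorable k r' (\<phi> ` V) = max_colorable k r V"
proof (rule antisym)
  obtain U where U: "U \<subseteq> V" "colorable k (geometric_graph r U)" "card U = max_colorable k r V"
    using max_colorable_witness fin by metis
  have "card (\<phi> ` U) \<le> max_colorable k r' (\<phi> ` V)"
  proof (intro card_le_max_colorable colorable_geometric_image[OF U(2)])
    show "inj_on \<phi> U"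
      using inj U(1) by (rule inj_on_subset)
    show "norm (u - v) \<le> r" if "u \<in> U" "v \<in> U" "norm (\<phi> u - \<phi> v) \<le> r'" for u v
      using that U(1) adj by (meson subsetD)
  qed (use fin U(1) in auto)
  then show "max_colorable k r V \<le> max_colorable k r' (\<phi> ` V)"
    using U card_image[OF inj_on_subset[OF inj U(1)]] by simp
next
  obtain U where U: "U \<subseteq> \<phi> ` V" "colorable k (geometric_graph r' U)"
    "card U = max_colorable k r' (\<phi> ` V)"
    using max_colorable_witness fin by (metis finite_imageI)
  let ?\<psi> = "inv_into V \<phi>"
  have "card (?\<psi> ` U) \<le> max_colorable k r V"
  proof (intro card_le_max_colorable colorable_geometric_image[OF U(2)])
    show "inj_on ?\<psi> U"
      using inj_on_inv_into U(1) by blast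
    show "?\<psi> ` U \<subseteq> V"
      using U(1) by (auto intro: inv_into_into)
    show "norm (u - v) \<le> r'" if "u \<in> U" "v \<in> U" "norm (?\<psi> u - ?\<psi> v) \<le> r" for u v
      using that U(1) adj[of "?\<psi> u" "?\<psi> v"] by (auto simp: inv_into_into f_inv_into_f subset_iff)
  qed (use fin in auto)
  then show "max_colorable k r' (\<phi> ` V) \<le> max_colorable k r V"
    using U card_image[OF inj_on_inv_into[OF U(1)]] by simp
qed

section \<open>Rounding to a grid\<close>

definition grid_index :: "real \<Rightarrow> real ^ 'd \<Rightarrow> int ^ 'd" where
  "grid_index \<delta> x = (\<chi> i. \<lfloor>x $ i / \<delta>\<rfloor>)"

definition grid_point :: "real \<Rightarrow> int ^ 'd \<Rightarrow> real ^ 'd" where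
  "grid_point \<delta> j = (\<chi> i. \<delta> * real_of_int (j $ i))"

text \<open>For \<open>\<delta> > 0\<close> these are the half-open cubes of side
  \<open>\<delta>\<close> with lower corner \<open>grid_point \<delta> j\<close>; they partition the
  space without overlapping faces.\<close>

definition grid_cell :: "real \<Rightarrow> int ^ 'd \<Rightarrow> (real ^ 'd) set" where
  "grid_cell \<delta> j = {x. grid_index \<delta> x = j}"

text \<open>Rounding moves a point by at most \<open>CARD('d) * \<delta>\<close>, hence changes a
  distance by at most twice that. The type argument only carries the dimension.\<close>

definition grid_radius :: "'d itself \<Rightarrow> real \<Rightarrow> real" where
  "grid_radius _ \<delta> = 1 + 2 * real CARD('d) * \<delta>"

text \<open>Each coordinate moves by at most \<open>\<delta>\<close>, and the Euclidean norm is
  bounded by the l1 norm, whence the factor \<open>CARD('d)\<close>.\<close>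

lemma norm_grid_point_diff_le:
  fixes x :: "real ^ 'd"
  assumes "\<delta> > 0"
  shows "norm (grid_point \<delta> (grid_index \<delta> x) - x) \<le> real CARD('d) * \<delta>"
proof -
  have "\<bar>\<delta> * real_of_int \<lfloor>x $ i / \<delta>\<rfloor> - x $ i\<bar> \<le> \<delta>" for i
  proof -
    have "\<delta> * real_of_int \<lfloor>x $ i / \<delta>\<rfloor> \<le> \<delta> * (x $ i / \<delta>)"
      using assms by (intro mult_left_mono) auto
    moreover have "\<delta> * (x $ i / \<delta>) \<le> \<delta> * (real_of_int \<lfloor>x $ i / \<delta>\<rfloor> + 1)"
      using assms by (intro mult_left_mono) linarith+
    ultimately show ?thesis
      using assms by (simp add: algebra_simps abs_le_iff)
  qed
  then have "(\<Sum>i\<in>UNIV. \<bar>(grid_point \<delta> (grid_index \<delta> x) - x) $ i\<bar>) \<le> (\<Sum>i\<in>(UNIV :: 'd set). \<delta>)"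
    by (intro sum_mono) (simp add: grid_point_def grid_index_def)
  then show ?thesis
    using norm_le_l1_cart[of "grid_point \<delta> (grid_index \<delta> x) - x"] by simp
qed

text \<open>Enlarging the radius by more than the rounding error keeps the pairs at distance exactly
  1 adjacent; the finitely many remaining pairs stay non-adjacent once the mesh is small.\<close>

lemma eventually_max_colorable_grid:
  fixes V :: "(real ^ 'd) set"
  assumes fin: "finite V"
  shows "\<forall>\<^sub>F \<delta> in at_right 0.
    max_colorable k (grid_radius TYPE('d) \<delta>) (grid_point \<delta> ` grid_index \<delta> ` V) = max_colorable k 1 V"
proof -
  let ?c = "real CARD('d)"
  let ?D = "\<lambda>\<delta> x :: real ^ 'd. grid_point \<delta> (grid_index \<delta> x)"
  have lim: "((\<lambda>\<delta>. e + 4 * ?c * \<delta>) \<longlongrightarrow> e + 4 * ?c * 0) (at_right 0)" for e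
    by (intro tendsto_intros)
  have pos: "\<forall>\<^sub>F \<delta> in at_right 0. \<delta> > (0 :: real)"
    by (rule eventually_at_right_less)
  have diff: "\<bar>norm (?D \<delta> u - ?D \<delta> v) - norm (u - v)\<bar> \<le> 2 * ?c * \<delta>" if "\<delta> > 0" for \<delta> u v
  proof -
    have "\<bar>norm (?D \<delta> u - ?D \<delta> v) - norm (u - v)\<bar> \<le> norm ((?D \<delta> u - ?D \<delta> v) - (u - v))"
      by (rule norm_triangle_ineq3)
    also have "\<dots> = norm ((?D \<delta> u - u) - (?D \<delta> v - v))"
      by (simp add: algebra_simps)
    also have "\<dots> \<le> norm (?D \<delta> u - u) + norm (?D \<delta> v - v)"
      by (rule norm_triangle_ineq4)
    finally show ?thesis
      using norm_grid_point_diff_le[OF that, of u] norm_grid_point_diff_le[OF that, of v] by linarith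
  qed
  \<comment> \<open>Rounding can shorten a distance by \<open>2 * ?c * \<delta>\<close> while the
    radius grows by the same amount, hence the margin \<open>4 * ?c * \<delta>\<close>.\<close>
  have ev1: "\<forall>\<^sub>F \<delta> in at_right 0. norm (u - v) > 1 \<longrightarrow> norm (u - v) > 1 + 4 * ?c * \<delta>"
    for u v :: "real ^ 'd"
  proof (cases "norm (u - v) > 1")
    case True
    then show ?thesis
      using order_tendstoD(2)[OF lim[of 1], of "norm (u - v)"] by (auto elim: eventually_mono)
  qed simp
  \<comment> \<open>This separation makes the rounding injective on \<open>V\<close>: points with a
    common grid point are within \<open>2 * ?c * \<delta>\<close> of each other.\<close>
  have ev2: "\<forall>\<^sub>F \<delta> in at_right 0. u \<noteq> v \<longrightarrow> norm (u - v) > 0 + 4 * ?c * \<delta>"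
    for u v :: "real ^ 'd"
  proof (cases "u = v")
    case False
    then show ?thesis
      using order_tendstoD(2)[OF lim[of 0], of "norm (u - v)"] by (auto elim: eventually_mono)
  qed simp
  have "\<forall>\<^sub>F \<delta> in at_right 0. \<forall>u\<in>V. \<forall>v\<in>V.
      (norm (u - v) > 1 \<longrightarrow> norm (u - v) > 1 + 4 * ?c * \<delta>) \<and>
      (u \<noteq> v \<longrightarrow> norm (u - v) > 0 + 4 * ?c * \<delta>)"
    using fin ev1 ev2 by (intro eventually_ball_finite eventually_conj ballI)
  then show ?thesis
    using pos
  proof eventually_elim
    case (elim \<delta>)
    have "?c > 0" by simp
    then have c\<delta>: "?c * \<delta> > 0"
      using elim(2) by (intro mult_pos_pos)
    have "max_colorable k (grid_radius TYPE('d) \<delta>) (?D \<delta> ` V) = max_colorable k 1 V"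
    proof (rule max_colorable_image[OF fin])
      show "inj_on (?D \<delta>) V"
      proof (rule inj_onI, rule ccontr)
        fix u v assume uv: "u \<in> V" "v \<in> V" "?D \<delta> u = ?D \<delta> v" "u \<noteq> v"
        then show False
          using diff[OF elim(2), of u v] elim(1) c\<delta> by fastforce
      qed
      show "norm (?D \<delta> u - ?D \<delta> v) \<le> grid_radius TYPE('d) \<delta> \<longleftrightarrow> norm (u - v) \<le> 1"
        if "u \<in> V" "v \<in> V" for u v
      proof -
        have "norm (u - v) > 1 \<longrightarrow> norm (u - v) > 1 + 4 * ?c * \<delta>"
          using elim(1) that by blast
        then show ?thesis
          using diff[OF elim(2), of u v] unfolding grid_radius_def by argo
      qed
    qed
    then show ?case
      by (simp add: image_image)
  qed
qed

section \<open>Boxes of integer vectors and the geometry of grid cells\<close>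

lemma vec_set_eq_image:
  "{j :: 'a ^ 'd. \<forall>i. j $ i \<in> A} = vec_lambda ` (UNIV \<rightarrow>\<^sub>E A)"
proof (intro equalityI subsetI)
  fix j :: "'a ^ 'd" assume "j \<in> {j. \<forall>i. j $ i \<in> A}"
  then show "j \<in> vec_lambda ` (UNIV \<rightarrow>\<^sub>E A)"
    by (intro image_eqI[of _ _ "vec_nth j"]) (auto simp: vec_nth_inverse)
qed (auto simp: PiE_iff)

lemma finite_vec_set:
  assumes "finite A"
  shows "finite {j :: 'a ^ 'd. \<forall>i. j $ i \<in> A}"
  unfolding vec_set_eq_image using assms by (intro finite_imageI finite_PiE) auto

lemma card_vec_set: "card {j :: 'a ^ 'd. \<forall>i. j $ i \<in> A} = card A ^ CARD('d)"
proof -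
  have "inj_on (vec_lambda :: _ \<Rightarrow> 'a ^ 'd) (UNIV \<rightarrow>\<^sub>E A)"
    by (auto simp: inj_on_def vec_lambda_inject)
  then show ?thesis
    unfolding vec_set_eq_image by (simp add: card_image card_PiE)
qed

lemma mem_grid_cell_iff:
  assumes "\<delta> > 0"
  shows "x \<in> grid_cell \<delta> j \<longleftrightarrow>
    (\<forall>i. \<delta> * real_of_int (j $ i) \<le> x $ i \<and> x $ i < \<delta> * real_of_int (j $ i) + \<delta>)"
proof -
  have "\<lfloor>x $ i / \<delta>\<rfloor> = j $ i \<longleftrightarrow>
      \<delta> * real_of_int (j $ i) \<le> x $ i \<and> x $ i < \<delta> * real_of_int (j $ i) + \<delta>" for i
    using assms by (simp add: floor_eq_iff pos_le_divide_eq pos_divide_less_eq algebra_simps)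
  then show ?thesis
    by (simp add: grid_cell_def grid_index_def vec_eq_iff)
qed

lemma grid_cell_borel [measurable]:
  fixes j :: "int ^ 'd"
  shows "grid_cell \<delta> j \<in> sets borel"
proof -
  have "grid_cell \<delta> j = {x \<in> space borel. \<forall>i\<in>UNIV. \<lfloor>x $ i / \<delta>\<rfloor> = j $ i}"
    by (simp add: grid_cell_def grid_index_def vec_eq_iff)
  also have "\<dots> \<in> sets borel"
    by measurable
  finally show ?thesis .
qed

lemma bounded_grid_cell:
  fixes j :: "int ^ 'd"
  assumes "\<delta> > 0"
  shows "bounded (grid_cell \<delta> j)"
proof -
  have "grid_cell \<delta> j \<subseteq> cball (grid_point \<delta> j) (real CARD('d) * \<delta>)"
    using norm_grid_point_diff_le[OF assms] by (auto simp: grid_cell_def dist_norm)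
  then show ?thesis
    by (rule bounded_subset[OF bounded_cball])
qed

lemma finite_grid_index_image:
  fixes Q :: "(real ^ 'd) set"
  assumes "bounded Q"
  shows "finite (grid_index \<delta> ` Q)"
proof -
  obtain b where b: "\<And>x. x \<in> Q \<Longrightarrow> norm x \<le> b"
    using assms unfolding bounded_iff by auto
  \<comment> \<open>The absolute value covers either sign of \<open>\<delta>\<close>; at
    \<open>\<delta> = 0\<close> both quotients are 0.\<close>
  have "\<lfloor>x $ i / \<delta>\<rfloor> \<in> {\<lfloor>- (b / \<bar>\<delta>\<bar>)\<rfloor>..\<lfloor>b / \<bar>\<delta>\<bar>\<rfloor>}" if "x \<in> Q" for x i
  proof -
    have "\<bar>x $ i / \<delta>\<bar> \<le> b / \<bar>\<delta>\<bar>"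
      using b[OF that] component_le_norm_cart[of x i] by (simp add: divide_right_mono)
    then have "- (b / \<bar>\<delta>\<bar>) \<le> x $ i / \<delta>" "x $ i / \<delta> \<le> b / \<bar>\<delta>\<bar>"
      by linarith+
    then show ?thesis
      by (simp only: atLeastAtMost_iff floor_mono simp_thms)
  qed
  then have "grid_index \<delta> ` Q \<subseteq> {j. \<forall>i. j $ i \<in> {\<lfloor>- (b / \<bar>\<delta>\<bar>)\<rfloor>..\<lfloor>b / \<bar>\<delta>\<bar>\<rfloor>}}"
    by (auto simp: grid_index_def)
  then show ?thesis
    by (rule finite_subset) (rule finite_vec_set, simp)
qed

text \<open>All cells are translates of the one at the origin. Translation invariance is applied to
  Lebesgue measure and returns to \<open>lborel\<close> through the completion.\<close>

lemma measure_grid_cell: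
  fixes j :: "int ^ 'd"
  assumes "\<delta> > 0"
  shows "measure lborel (grid_cell \<delta> j) = measure lborel (grid_cell \<delta> (0 :: int ^ 'd))"
proof -
  have eq: "x - grid_point \<delta> j \<in> grid_cell \<delta> 0 \<longleftrightarrow> x \<in> grid_cell \<delta> j" for x
    unfolding mem_grid_cell_iff[OF assms] by (simp add: grid_point_def algebra_simps)
  have "grid_cell \<delta> j = (+) (grid_point \<delta> j) ` grid_cell \<delta> 0"
  proof (intro equalityI subsetI)
    fix x assume "x \<in> grid_cell \<delta> j"
    then show "x \<in> (+) (grid_point \<delta> j) ` grid_cell \<delta> 0"
      by (intro image_eqI[of _ _ "x - grid_point \<delta> j"]) (simp_all add: eq)
  next
    fix x assume "x \<in> (+) (grid_point \<delta> j) ` grid_cell \<delta> 0"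
    then obtain y where "y \<in> grid_cell \<delta> 0" "x = grid_point \<delta> j + y"
      by blast
    then show "x \<in> grid_cell \<delta> j"
      using eq[of x] by simp
  qed
  then have "measure lebesgue (grid_cell \<delta> j) = measure lebesgue (grid_cell \<delta> (0 :: int ^ 'd))"
    by (simp add: measure_translation)
  then show ?thesis
    by (simp add: measure_completion)
qed

section \<open>Subdividing a cell into smaller cells\<close>

text \<open>The cell \<open>z\<close> of side \<open>s\<close> is divided into the cells \<open>subindex n z j\<close> of side \<open>s / n\<close>, \<open>j \<in> block n\<close>.\<close>

definition block :: "nat \<Rightarrow> (int ^ 'd) set" where
  "block n = {j. \<forall>i. j $ i \<in> {0..<int n}}"

definition subindex :: "nat \<Rightarrow> int ^ 'd \<Rightarrow> int ^ 'd \<Rightarrow> int ^ 'd" where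
  "subindex n z j = (\<chi> i. int n * z $ i + j $ i)"

lemma finite_block [simp]: "finite (block n)"
  unfolding block_def by (rule finite_vec_set) simp

lemma card_block: "card (block n :: (int ^ 'd) set) = n ^ CARD('d)"
  unfolding block_def card_vec_set by simp

text \<open>Division with remainder by \<open>n\<close> recovers \<open>z\<close> as the quotient
  and \<open>j\<close> as the remainder in each coordinate.\<close>

lemma subindex_inject:
  assumes "j \<in> block n" "j' \<in> block n" "subindex n z j = subindex n z' j'"
  shows "z = z' \<and> j = j'"
proof -
  have *: "int n * z $ i + j $ i = int n * z' $ i + j' $ i" for i
    using arg_cong[OF assms(3), of "\<lambda>v. v $ i"] by (simp add: subindex_def)
  have b: "0 \<le> j $ i" "j $ i < int n" "0 \<le> j' $ i" "j' $ i < int n" for i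
    using assms(1,2) by (auto simp: block_def)
  have "z $ i = z' $ i" for i
  proof -
    have "(int n * z $ i + j $ i) div int n = z $ i" "(int n * z' $ i + j' $ i) div int n = z' $ i"
      using b[of i] by simp_all
    then show ?thesis
      using * by metis
  qed
  then show ?thesis
    using * by (simp add: vec_eq_iff)
qed

text \<open>Since the floor of \<open>y / n\<close> is \<open>\<lfloor>y\<rfloor> div n\<close>, the
  coarse index is the quotient of the fine one, and the remainder is the position within the
  block.\<close>

lemma grid_cell_subdivision:
  fixes z :: "int ^ 'd"
  assumes "s > 0" "n > 0"
  shows "x \<in> grid_cell s z \<longleftrightarrow> grid_index (s / real n) x \<in> subindex n z ` block n"
proof -
  have fl: "\<lfloor>x $ i / s\<rfloor> = \<lfloor>x $ i / (s / real n)\<rfloor> div int n" for i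
  proof -
    have "\<lfloor>x $ i / s\<rfloor> = \<lfloor>(x $ i / (s / real n)) / real n\<rfloor>"
      using assms by simp
    also have "\<dots> = \<lfloor>x $ i / (s / real n)\<rfloor> div int n"
      using floor_divide_real_eq_div[of "int n" "x $ i / (s / real n)"] by simp
    finally show ?thesis .
  qed
  show ?thesis
  proof
    assume x: "x \<in> grid_cell s z"
    let ?j = "\<chi> i. \<lfloor>x $ i / (s / real n)\<rfloor> mod int n"
    have "?j \<in> block n"
      using assms by (simp add: block_def)
    moreover have "grid_index (s / real n) x = subindex n z ?j"
    proof -
      have "\<lfloor>x $ i / (s / real n)\<rfloor> div int n = z $ i" for i
        using x fl[of i] by (auto simp: grid_cell_def grid_index_def)
      then have "\<lfloor>x $ i / (s / real n)\<rfloor> = int n * z $ i + \<lfloor>x $ i / (s / real n)\<rfloor> mod int n" for i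
        by (metis mult_div_mod_eq)
      then show ?thesis
        unfolding grid_index_def subindex_def vec_eq_iff vec_lambda_beta by blast
    qed
    ultimately show "grid_index (s / real n) x \<in> subindex n z ` block n"
      by blast
  next
    assume "grid_index (s / real n) x \<in> subindex n z ` block n"
    then obtain j where j: "j \<in> block n" "grid_index (s / real n) x = subindex n z j"
      by blast
    have "\<lfloor>x $ i / s\<rfloor> = z $ i" for i
    proof -
      have "\<lfloor>x $ i / (s / real n)\<rfloor> = int n * z $ i + j $ i"
        using arg_cong[OF j(2), of "\<lambda>v. v $ i"] by (simp add: grid_index_def subindex_def)
      moreover have "0 \<le> j $ i" "j $ i < int n"
        using j(1) by (auto simp: block_def)
      ultimately show ?thesis
        unfolding fl by simp
    qed
    then show "x \<in> grid_cell s z"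
      by (simp add: grid_cell_def grid_index_def vec_eq_iff)
  qed
qed

text \<open>Separates the corner of the large cell from the position inside it, so that a
  translation removes the dependence on \<open>z\<close>.\<close>

lemma grid_point_subindex:
  assumes "n > 0"
  shows "grid_point (s / real n) (subindex n z j) = grid_point s z + grid_point (s / real n) j"
  using assms by (simp add: grid_point_def subindex_def vec_eq_iff field_simps)

text \<open>A bound independent of the mesh, which supplies the dominating function when the mesh
  tends to 0.\<close>

lemma max_colorable_grid_le_card:
  assumes "finite V"
  shows "max_colorable k r (grid_point \<delta> ` grid_index \<delta> ` V) \<le> card V"
proof -
  have "max_colorable k r (grid_point \<delta> ` grid_index \<delta> ` V) \<le> card (grid_point \<delta> ` grid_index \<delta> ` V)"
    using assms by (intro max_colorable_le_card) auto
  also have "\<dots> \<le> card V"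
    using assms by (metis card_image_le finite_imageI order_trans)
  finally show ?thesis .
qed

lemma max_colorable_translation:
  assumes "finite V"
  shows "max_colorable k r ((+) a ` V) = max_colorable k r V"
  using assms by (intro max_colorable_image) auto

section \<open>The set of occupied cells of a Poisson process\<close>

text \<open>Records which cells are occupied but not how many points they hold. This is exactly what
  rounding retains, and its law can be computed from the counts.\<close>

definition hit :: "'i set \<Rightarrow> ('i \<Rightarrow> 'a set) \<Rightarrow> 'a set \<Rightarrow> 'i set" where
  "hit I C V = {i \<in> I. V \<inter> C i \<noteq> {}}"

lemma hit_subset: "hit I C V \<subseteq> I"
  by (auto simp: hit_def)

context poisson_point_process
begin

text \<open>Local finiteness rules out the default value 0 of \<open>card\<close> on infinite
  sets.\<close>

lemma card_eq_0_iff_Int_empty: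
  assumes "w \<in> space M" "bounded B"
  shows "card (X w \<inter> B) = 0 \<longleftrightarrow> X w \<inter> B = {}"
  using locally_finite[OF assms] by simp

text \<open>Rewrites the event as a conjunction of conditions on single counts, the form to which
  independence applies.\<close>

lemma hit_event_eq:
  assumes C: "\<And>i. i \<in> I \<Longrightarrow> C i \<in> sets borel \<and> bounded (C i)" and W: "W \<subseteq> I"
  shows "{w \<in> space M. hit I C (X w) = W} =
    {w \<in> space M. \<forall>i\<in>I. card (X w \<inter> C i) \<in> (if i \<in> W then - {0} else {0})}"
proof -
  have "hit I C (X w) = W \<longleftrightarrow>
      (\<forall>i\<in>I. card (X w \<inter> C i) \<in> (if i \<in> W then - {0} else {0}))" if "w \<in> space M" for w
  proof -
    have "card (X w \<inter> C i) \<in> (if i \<in> W then - {0} else {0}) \<longleftrightarrow> (X w \<inter> C i \<noteq> {} \<longleftrightarrow> i \<in> W)"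
      if "i \<in> I" for i
      using card_eq_0_iff_Int_empty[OF \<open>w \<in> space M\<close>] C[OF that] by simp
    then have "(\<forall>i\<in>I. card (X w \<inter> C i) \<in> (if i \<in> W then - {0} else {0})) \<longleftrightarrow>
        (\<forall>i\<in>I. (X w \<inter> C i \<noteq> {} \<longleftrightarrow> i \<in> W))"
      by (intro ball_cong refl)
    then show ?thesis
      using W unfolding hit_def by blast
  qed
  then show ?thesis
    by blast
qed

lemma hit_event_sets:
  assumes fin: "finite I" and C: "\<And>i. i \<in> I \<Longrightarrow> C i \<in> sets borel \<and> bounded (C i)"
  shows "{w \<in> space M. hit I C (X w) = W} \<in> events"
proof (cases "W \<subseteq> I")
  case True
  have "{w \<in> space M. \<forall>i\<in>I. card (X w \<inter> C i) \<in> (if i \<in> W then - {0} else {0})} \<in> events"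
  proof (rule sets.sets_Collect_finite_All[OF _ fin])
    fix i assume "i \<in> I"
    with C have m: "(\<lambda>w. card (X w \<inter> C i)) \<in> measurable M (count_space UNIV)"
      by (intro measurable_count) auto
    show "{w \<in> space M. card (X w \<inter> C i) \<in> (if i \<in> W then - {0} else {0})} \<in> events"
      using measurable_sets[OF m, of "if i \<in> W then - {0} else {0}"]
      by (auto simp: vimage_def Int_def conj_commute)
  qed
  then show ?thesis
    by (subst hit_event_eq) (use C True in auto)
next
  case False
  then have "{w \<in> space M. hit I C (X w) = W} = {}"
    by (auto simp: hit_def)
  then show ?thesis
    by (metis sets.empty_sets)
qed

lemma measurable_hit:
  assumes "finite I" and "\<And>i. i \<in> I \<Longrightarrow> C i \<in> sets borel \<and> bounded (C i)"
  shows "(\<lambda>w. hit I C (X w)) \<in> measurable M (count_space (Pow I))"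
proof (subst measurable_count_space_eq2)
  show "finite (Pow I)"
    using assms(1) by simp
  show "(\<lambda>w. hit I C (X w)) \<in> space M \<rightarrow> Pow I \<and>
      (\<forall>W\<in>Pow I. (\<lambda>w. hit I C (X w)) -` {W} \<inter> space M \<in> events)"
  proof (intro conjI ballI)
    fix W
    have "(\<lambda>w. hit I C (X w)) -` {W} \<inter> space M = {w \<in> space M. hit I C (X w) = W}"
      by auto
    then show "(\<lambda>w. hit I C (X w)) -` {W} \<inter> space M \<in> events"
      using hit_event_sets[OF assms] by simp
  qed (auto simp: hit_def)
qed

text \<open>The hit set takes values in a finite discrete space, so \<open>h\<close> may be
  arbitrary.\<close>

lemma borel_measurable_hit:
  assumes "finite I" and "\<And>i. i \<in> I \<Longrightarrow> C i \<in> sets borel \<and> bounded (C i)"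
  shows "(\<lambda>w. h (hit I C (X w)) :: real) \<in> borel_measurable M"
  by (rule measurable_compose[OF measurable_hit[OF assms]]) (auto simp: measurable_count_space_eq1)

text \<open>The product Bernoulli law: each cell of volume \<open>v\<close> is empty with
  probability \<open>exp (- (lam * v))\<close>, independently of the others.\<close>

definition hit_weight :: "real \<Rightarrow> 'i set \<Rightarrow> 'i set \<Rightarrow> real" where
  "hit_weight v I W = (1 - exp (- (lam * v))) ^ card W * exp (- (lam * v)) ^ card (I - W)"

text \<open>Counts in disjoint cells are independent, and a cell is empty with the Poisson weight at
  0.\<close>

lemma prob_hit:
  assumes fin: "finite I" and C: "\<And>i. i \<in> I \<Longrightarrow> C i \<in> sets borel \<and> bounded (C i)"
    and disj: "disjoint_family_on C I" and vol: "\<And>i. i \<in> I \<Longrightarrow> measure lborel (C i) = v"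
    and W: "W \<subseteq> I"
  shows "prob {w \<in> space M. hit I C (X w) = W} = hit_weight v I W"
\<comment> \<open>The product rule for independent variables asks for a non-empty index set.\<close>
proof (cases "I = {}")
  case True
  then show ?thesis
    using W by (simp add: hit_def hit_weight_def prob_space)
next
  case False
  define A :: "_ \<Rightarrow> nat set" where "A i = (if i \<in> W then - {0} else {0})" for i
  define E where "E i = {w \<in> space M. card (X w \<inter> C i) \<in> A i}" for i
  \<comment> \<open>Independence is available for families indexed by an initial segment of the
    naturals, so \<open>I\<close> is enumerated.\<close>
  obtain e where e: "bij_betw e {..<card I} I"
    using ex_bij_betw_nat_finite[OF fin] by (auto simp: lessThan_atLeast0)
  have eI: "e ` {..<card I} = I"
    using e by (auto simp: bij_betw_def)
  have "card I > 0"
    using False fin by (simp add: card_gt_0_iff)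
  then have ne: "{..<card I} \<noteq> {}"
    by (simp add: lessThan_empty_iff)
  have B: "i < card I \<Longrightarrow> (C \<circ> e) i \<in> sets borel \<and> bounded ((C \<circ> e) i)" for i
    using C eI by auto
  have "disjoint_family_on (C \<circ> e) {..<card I}"
    unfolding disjoint_family_on_def
  proof (intro ballI impI)
    fix i j assume ij: "i \<in> {..<card I}" "j \<in> {..<card I}" "i \<noteq> j"
    then have "e i \<in> I" "e j \<in> I" "e i \<noteq> e j"
      using eI bij_betw_imp_inj_on[OF e] by (auto dest: inj_onD)
    then show "(C \<circ> e) i \<inter> (C \<circ> e) j = {}"
      using disj by (simp add: disjoint_family_onD)
  qed
  from indep_counts[of "card I" "C \<circ> e", OF B this]
  have ind: "indep_vars (\<lambda>_. count_space UNIV) (\<lambda>i w. card (X w \<inter> (C \<circ> e) i)) {..<card I}"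
    by simp
  have "prob (\<Inter>i\<in>{..<card I}. (\<lambda>w. card (X w \<inter> (C \<circ> e) i)) -` A (e i) \<inter> space M) =
      (\<Prod>i\<in>{..<card I}. prob ((\<lambda>w. card (X w \<inter> (C \<circ> e) i)) -` A (e i) \<inter> space M))"
    by (rule indep_varsD_finite[OF ind ne]) auto
  moreover have "(\<lambda>i. (\<lambda>w. card (X w \<inter> (C \<circ> e) i)) -` A (e i) \<inter> space M) = (\<lambda>i. E (e i))"
    unfolding E_def by auto
  ultimately have "prob (\<Inter>i\<in>{..<card I}. E (e i)) = (\<Prod>i\<in>{..<card I}. prob (E (e i)))"
    by metis
  moreover have "(\<Inter>i\<in>{..<card I}. E (e i)) = (\<Inter>i\<in>I. E i)"
    using arg_cong[OF eI, of "\<lambda>J. \<Inter> (E ` J)"] by (simp only: image_image)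
  moreover have "(\<Prod>i\<in>{..<card I}. prob (E (e i))) = (\<Prod>i\<in>I. prob (E i))"
    using prod.reindex_bij_betw[OF e] by simp
  moreover have "(\<Inter>i\<in>I. E i) = {w \<in> space M. hit I C (X w) = W}"
  proof -
    have "{w \<in> space M. hit I C (X w) = W} = {w \<in> space M. \<forall>i\<in>I. card (X w \<inter> C i) \<in> A i}"
      unfolding A_def by (rule hit_event_eq[OF C W])
    then show ?thesis
      unfolding E_def using False by blast
  qed
  ultimately have "prob {w \<in> space M. hit I C (X w) = W} = (\<Prod>i\<in>I. prob (E i))"
    by (simp only:)
  also have "\<dots> = (\<Prod>i\<in>I. if i \<in> W then 1 - exp (- (lam * v)) else exp (- (lam * v)))"
  proof (rule prod.cong[OF refl])
    fix i assume i: "i \<in> I"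
    let ?Z = "{w \<in> space M. card (X w \<inter> C i) = 0}"
    have Z: "prob ?Z = exp (- (lam * v))"
      using prob_count[of "C i" 0] C[OF i] vol[OF i] by simp
    have m: "(\<lambda>w. card (X w \<inter> C i)) \<in> measurable M (count_space UNIV)"
      using C[OF i] by (intro measurable_count) auto
    have "?Z = (\<lambda>w. card (X w \<inter> C i)) -` {0} \<inter> space M"
      by auto
    then have "?Z \<in> events"
      using measurable_sets[OF m, of "{0}"] by (metis UNIV_I sets_count_space Pow_UNIV)
    moreover have "E i = space M - ?Z" if "i \<in> W"
      using that by (auto simp: E_def A_def)
    moreover have "E i = ?Z" if "i \<notin> W"
      using that by (auto simp: E_def A_def)
    ultimately show "prob (E i) = (if i \<in> W then 1 - exp (- (lam * v)) else exp (- (lam * v)))"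
      using Z prob_compl[of ?Z] by simp
  qed
  also have "\<dots> = (\<Prod>i\<in>W. 1 - exp (- (lam * v))) * (\<Prod>i\<in>I - W. exp (- (lam * v)))"
    using fin W by (simp add: prod.If_cases Int_absorb1 Diff_eq)
  finally show ?thesis
    by (simp add: hit_weight_def)
qed

text \<open>The right-hand side sees only \<open>I\<close> and the common volume \<open>v\<close>,
  not the position of the cells; stationarity rests on this.\<close>

lemma expectation_hit:
  fixes h :: "'i set \<Rightarrow> real"
  assumes fin: "finite I" and C: "\<And>i. i \<in> I \<Longrightarrow> C i \<in> sets borel \<and> bounded (C i)"
    and disj: "disjoint_family_on C I" and vol: "\<And>i. i \<in> I \<Longrightarrow> measure lborel (C i) = v"
  shows "expectation (\<lambda>w. h (hit I C (X w))) = (\<Sum>W\<in>Pow I. h W * hit_weight v I W)"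
proof -
  let ?E = "\<lambda>W. {w \<in> space M. hit I C (X w) = W}"
  have "expectation (\<lambda>w. h (hit I C (X w))) = expectation (\<lambda>w. \<Sum>W\<in>Pow I. h W * indicator (?E W) w)"
  proof (rule Bochner_Integration.integral_cong[OF refl])
    fix w assume "w \<in> space M"
    then have "h W * indicator (?E W) w = (if W = hit I C (X w) then h W else 0)" for W
      by (simp add: indicator_def)
    then show "h (hit I C (X w)) = (\<Sum>W\<in>Pow I. h W * indicator (?E W) w)"
      using fin hit_subset[of I C "X w"] by simp
  qed
  also have "\<dots> = (\<Sum>W\<in>Pow I. expectation (\<lambda>w. h W * indicator (?E W) w))"
  proof (rule Bochner_Integration.integral_sum)
    fix W
    have "?E W \<in> events"
      by (rule hit_event_sets[OF fin C])
    then show "integrable M (\<lambda>w. h W * indicator (?E W) w)"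
      by (simp add: emeasure_eq_measure)
  qed
  also have "\<dots> = (\<Sum>W\<in>Pow I. h W * hit_weight v I W)"
  proof (rule sum.cong[OF refl])
    fix W assume "W \<in> Pow I"
    then have "prob (?E W) = hit_weight v I W"
      by (intro prob_hit[OF fin C disj vol]) auto
    moreover have "?E W \<in> events"
      by (rule hit_event_sets[OF fin C])
    ultimately show "expectation (\<lambda>w. h W * indicator (?E W) w) = h W * hit_weight v I W"
      by simp
  qed
  finally show ?thesis .
qed

section \<open>Moments of the Poisson counts\<close>

lemma integrable_exp_count:
  assumes "lam > 0" "B \<in> sets borel" "bounded B"
  shows "integrable M (\<lambda>w. exp (real (card (X w \<inter> B))))"
proof -
  let ?N = "\<lambda>w. card (X w \<inter> B)"
  let ?E = "\<lambda>n. {w \<in> space M. ?N w = n}"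
  define \<mu> where "\<mu> = lam * measure lborel B"
  have \<mu>: "\<mu> \<ge> 0"
    using assms by (simp add: \<mu>_def)
  have m [measurable]: "?N \<in> measurable M (count_space UNIV)"
    by (rule measurable_count[OF assms(2,3)])
  have "(\<integral>\<^sup>+w. ennreal (exp (real (?N w))) \<partial>M) =
      (\<integral>\<^sup>+w. (\<Sum>n. ennreal (exp (real n)) * indicator (?E n) w) \<partial>M)"
  proof (rule nn_integral_cong)
    fix w assume w: "w \<in> space M"
    have "(\<Sum>n. ennreal (exp (real n)) * indicator (?E n) w) =
        (\<Sum>n\<in>{?N w}. ennreal (exp (real n)) * indicator (?E n) w)"
      using w by (intro suminf_finite) auto
    then show "ennreal (exp (real (?N w))) = (\<Sum>n. ennreal (exp (real n)) * indicator (?E n) w)"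
      using w by simp
  qed
  also have "\<dots> = (\<Sum>n. \<integral>\<^sup>+w. ennreal (exp (real n)) * indicator (?E n) w \<partial>M)"
    by (rule nn_integral_suminf) measurable
  also have "\<dots> = (\<Sum>n. ennreal (exp (real n) * (\<mu> ^ n / fact n * exp (- \<mu>))))"
  proof (rule suminf_cong)
    fix n
    have "(\<integral>\<^sup>+w. ennreal (exp (real n)) * indicator (?E n) w \<partial>M) = ennreal (exp (real n)) * emeasure M (?E n)"
      by (rule nn_integral_cmult_indicator) measurable
    also have "\<dots> = ennreal (exp (real n) * (\<mu> ^ n / fact n * exp (- \<mu>)))"
      unfolding emeasure_eq_measure prob_count[OF assms(2,3)] \<mu>_def[symmetric]
      using \<mu> by (intro ennreal_mult[symmetric]) auto
    finally show "(\<integral>\<^sup>+w. ennreal (exp (real n)) * indicator (?E n) w \<partial>M) =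
        ennreal (exp (real n) * (\<mu> ^ n / fact n * exp (- \<mu>)))" .
  qed
  also have "\<dots> < \<infinity>"
  proof -
    \<comment> \<open>Against the Poisson weights, \<open>exp (real n)\<close> turns the parameter
      \<open>\<mu>\<close> into \<open>exp 1 * \<mu>\<close>, so the series is again
      exponential.\<close>
    have "summable (\<lambda>n. exp (- \<mu>) * ((exp 1 * \<mu>) ^ n /\<^sub>R fact n))"
      by (intro summable_mult summable_exp_generic)
    then have "summable (\<lambda>n. exp (real n) * (\<mu> ^ n / fact n * exp (- \<mu>)))"
      by (rule back_subst[of summable])
         (simp add: fun_eq_iff power_mult_distrib exp_of_nat_mult[of _ 1, simplified, symmetric] field_simps)
    then show ?thesis
      using \<mu> by (subst suminf_ennreal2) auto
  qed
  finally show ?thesis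
    by (intro integrableI_nonneg) auto
qed

lemma integrable_count_power:
  assumes "lam > 0" "B \<in> sets borel" "bounded B" "p \<le> 2"
  shows "integrable M (\<lambda>w. real (card (X w \<inter> B)) ^ p)"
proof (rule Bochner_Integration.integrable_bound)
  show "integrable M (\<lambda>w. 2 * exp (real (card (X w \<inter> B))))"
    using integrable_exp_count[OF assms(1-3)] by simp
  have m [measurable]: "(\<lambda>w. card (X w \<inter> B)) \<in> measurable M (count_space UNIV)"
    by (rule measurable_count[OF assms(2,3)])
  show "(\<lambda>w. real (card (X w \<inter> B)) ^ p) \<in> borel_measurable M"
    by measurable
  \<comment> \<open>The constant 2 clears the denominator of the quadratic Taylor term, which
    controls the powers up to 2.\<close>
  have "x ^ p \<le> 2 * exp x" if "x \<ge> 0" for x :: real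
  proof -
    have "1 + x + x\<^sup>2 / 2 \<le> exp x"
      using exp_lower_Taylor_quadratic[OF that] by simp
    then have "1 \<le> 2 * exp x" "x \<le> 2 * exp x" "x\<^sup>2 \<le> 2 * exp x"
      using exp_ge_add_one_self[of x] zero_le_power2[of x] that by linarith+
    moreover have "p = 0 \<or> p = 1 \<or> p = 2"
      using \<open>p \<le> 2\<close> by auto
    ultimately show ?thesis
      by auto
  qed
  then show "AE w in M. norm (real (card (X w \<inter> B)) ^ p) \<le> norm (2 * exp (real (card (X w \<inter> B))))"
    by simp
qed

end

section \<open>Stationarity and decorrelation of the cell counts\<close>

text \<open>Indexed by the position inside the cell \<open>z\<close> rather than by the absolute
  small cell, so that the values for different \<open>z\<close> are comparable.\<close>

definition block_hit :: "real \<Rightarrow> nat \<Rightarrow> int ^ 'd \<Rightarrow> (real ^ 'd) set \<Rightarrow> (int ^ 'd) set" where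
  "block_hit s n z V = hit (block n) (\<lambda>j. grid_cell (s / real n) (subindex n z j)) V"

text \<open>A deterministic function of the occupied positions with no reference to
  \<open>z\<close>: one function serves all cells.\<close>

definition block_value :: "nat \<Rightarrow> real \<Rightarrow> nat \<Rightarrow> (int ^ 'd) set \<Rightarrow> nat" where
  "block_value k s n W = max_colorable k (grid_radius TYPE('d) (s / real n)) (grid_point (s / real n) ` W)"

text \<open>The rounded configuration in the cell \<open>z\<close> is the set of occupied positions
  translated by \<open>grid_point s z\<close>, and a translation preserves the maximum.\<close>

lemma block_value_hit:
  fixes V :: "(real ^ 'd) set"
  assumes "s > 0" "n > 0"
  shows "block_value k s n (block_hit s n z V) = max_colorable k (grid_radius TYPE('d) (s / real n))
    (grid_point (s / real n) ` grid_index (s / real n) ` (V \<inter> grid_cell s z))"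
proof -
  have "grid_index (s / real n) ` (V \<inter> grid_cell s z) = subindex n z ` block_hit s n z V"
  proof (intro equalityI subsetI)
    fix y assume "y \<in> grid_index (s / real n) ` (V \<inter> grid_cell s z)"
    then obtain x where x: "x \<in> V" "x \<in> grid_cell s z" "y = grid_index (s / real n) x"
      by blast
    then obtain j where "j \<in> block n" "y = subindex n z j"
      using grid_cell_subdivision[OF assms, of x z] by blast
    then show "y \<in> subindex n z ` block_hit s n z V"
      using x by (intro image_eqI[of _ _ j]) (auto simp: block_hit_def hit_def grid_cell_def)
  next
    fix y assume "y \<in> subindex n z ` block_hit s n z V"
    then obtain j x where "j \<in> block n" "y = subindex n z j" "x \<in> V" "grid_index (s / real n) x = y"
      by (auto simp: block_hit_def hit_def grid_cell_def)
    then show "y \<in> grid_index (s / real n) ` (V \<inter> grid_cell s z)"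
      using grid_cell_subdivision[OF assms, of x z] by (intro image_eqI[of _ _ x]) auto
  qed
  then have "grid_point (s / real n) ` grid_index (s / real n) ` (V \<inter> grid_cell s z) =
      (+) (grid_point s z) ` grid_point (s / real n) ` block_hit s n z V"
    using grid_point_subindex[OF assms(2), of s z] by (simp add: image_image)
  moreover have "finite (block_hit s n z V)"
    unfolding block_hit_def using finite_block hit_subset by (metis finite_subset)
  ultimately show ?thesis
    by (simp add: block_value_def max_colorable_translation)
qed

lemma block_value_le_card:
  fixes V :: "(real ^ 'd) set"
  assumes "s > 0" "n > 0" "finite (V \<inter> grid_cell s z)"
  shows "block_value k s n (block_hit s n z V) \<le> card (V \<inter> grid_cell s z)"
  unfolding block_value_hit[OF assms(1,2)] by (rule max_colorable_grid_le_card[OF assms(3)])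

lemma filterlim_divide_Suc_at_right_0:
  assumes "s > 0"
  shows "filterlim (\<lambda>n. s / real (Suc n)) (at_right 0) sequentially"
  unfolding filterlim_at
proof
  show "(\<lambda>n. s / real (Suc n)) \<longlonglongrightarrow> 0"
    using LIMSEQ_Suc[OF lim_const_over_n[of s]] by simp
qed (use assms in auto)

text \<open>For a fixed configuration the sequence is eventually constant, from an index depending
  on it. \<open>Suc n\<close> keeps the number of subdivisions positive throughout.\<close>

lemma block_value_LIMSEQ:
  fixes V :: "(real ^ 'd) set"
  assumes "s > 0" "finite (V \<inter> grid_cell s z)"
  shows "(\<lambda>n. real (block_value k s (Suc n) (block_hit s (Suc n) z V)))
    \<longlonglongrightarrow> real (max_colorable k 1 (V \<inter> grid_cell s z))"
proof (rule tendsto_eventually)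
  have "\<forall>\<^sub>F n in sequentially. max_colorable k (grid_radius TYPE('d) (s / real (Suc n)))
      (grid_point (s / real (Suc n)) ` grid_index (s / real (Suc n)) ` (V \<inter> grid_cell s z)) =
      max_colorable k 1 (V \<inter> grid_cell s z)"
    by (rule eventually_compose_filterlim[OF eventually_max_colorable_grid[OF assms(2)]
        filterlim_divide_Suc_at_right_0[OF assms(1)]])
  then show "\<forall>\<^sub>F n in sequentially. real (block_value k s (Suc n) (block_hit s (Suc n) z V)) =
      real (max_colorable k 1 (V \<inter> grid_cell s z))"
    unfolding block_value_hit[OF assms(1) zero_less_Suc] by (rule eventually_mono) simp
qed

lemma block_cell_borel_bounded:
  fixes z :: "int ^ 'd"
  assumes "s > 0" "n > 0"
  shows "grid_cell (s / real n) (subindex n z j) \<in> sets borel \<and>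
    bounded (grid_cell (s / real n) (subindex n z j))"
  using assms by (simp add: grid_cell_borel bounded_grid_cell)

text \<open>Pairs index the small cells of several large cells at once, so that their joint
  occupation is a single hit set.\<close>

lemma disjoint_family_block_cells:
  fixes S :: "(int ^ 'd) set"
  shows "disjoint_family_on (\<lambda>p. grid_cell (s / real n) (subindex n (fst p) (snd p))) (S \<times> block n)"
  unfolding disjoint_family_on_def
proof (intro ballI impI)
  fix p q :: "(int ^ 'd) \<times> (int ^ 'd)"
  assume "p \<in> S \<times> block n" "q \<in> S \<times> block n" "p \<noteq> q"
  then have "subindex n (fst p) (snd p) \<noteq> subindex n (fst q) (snd q)"
    using subindex_inject[of "snd p" n "snd q" "fst p" "fst q"] by (auto simp: prod_eq_iff)
  then show "grid_cell (s / real n) (subindex n (fst p) (snd p)) \<inter>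
      grid_cell (s / real n) (subindex n (fst q) (snd q)) = {}"
    by (auto simp: grid_cell_def)
qed

lemma disjoint_family_block_cells1:
  fixes z :: "int ^ 'd"
  shows "disjoint_family_on (\<lambda>j. grid_cell (s / real n) (subindex n z j)) (block n)"
  unfolding disjoint_family_on_def
proof (intro ballI impI)
  fix i j :: "int ^ 'd"
  assume "i \<in> block n" "j \<in> block n" "i \<noteq> j"
  then have "subindex n z i \<noteq> subindex n z j"
    using subindex_inject[of i n j z z] by auto
  then show "grid_cell (s / real n) (subindex n z i) \<inter> grid_cell (s / real n) (subindex n z j) = {}"
    by (auto simp: grid_cell_def)
qed

context poisson_point_process
begin

section \<open>Measurability, and the law of the occupied positions at a fixed mesh\<close>

lemma borel_measurable_block_hit:
  assumes "s > 0" "n > 0"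
  shows "(\<lambda>w. h (block_hit s n z (X w)) :: real) \<in> borel_measurable M"
  unfolding block_hit_def
  by (rule borel_measurable_hit[OF finite_block block_cell_borel_bounded[OF assms]])

text \<open>The maximum is a pointwise limit of functions of hit sets. The cells are cut down to
  \<open>Q\<close>, so any bounded Borel set is allowed; their unequal volumes do not affect
  measurability.\<close>

lemma borel_measurable_max_colorable:
  assumes Q: "Q \<in> sets borel" "bounded Q"
  shows "(\<lambda>w. real (max_colorable k 1 (X w \<inter> Q))) \<in> borel_measurable M"
proof (rule borel_measurable_LIMSEQ_real)
  let ?d = "\<lambda>n. 1 / real (Suc n)"
  let ?h = "\<lambda>n W. real (max_colorable k (grid_radius TYPE('d) (?d n)) (grid_point (?d n) ` W))"
  let ?H = "\<lambda>n. hit (grid_index (?d n) ` Q) (\<lambda>j. Q \<inter> grid_cell (?d n) j)"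
  have H: "?H n V = grid_index (?d n) ` (V \<inter> Q)" for n V
    by (auto simp: hit_def grid_cell_def intro: rev_image_eqI)
  show "(\<lambda>w. ?h n (?H n (X w))) \<in> borel_measurable M" for n
    by (rule borel_measurable_hit[OF finite_grid_index_image[OF Q(2)]])
       (use Q in \<open>simp add: sets.Int bounded_Int\<close>)
  fix w assume "w \<in> space M"
  then have fin: "finite (X w \<inter> Q)"
    using locally_finite Q(2) by blast
  have "\<forall>\<^sub>F n in sequentially. max_colorable k (grid_radius TYPE('d) (?d n))
      (grid_point (?d n) ` grid_index (?d n) ` (X w \<inter> Q)) = max_colorable k 1 (X w \<inter> Q)"
    by (rule eventually_compose_filterlim[OF eventually_max_colorable_grid[OF fin]
        filterlim_divide_Suc_at_right_0[OF zero_less_one]])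
  then show "(\<lambda>n. ?h n (?H n (X w))) \<longlonglongrightarrow> real (max_colorable k 1 (X w \<inter> Q))"
    unfolding H by (intro tendsto_eventually) simp
qed

text \<open>The right-hand side does not mention \<open>z\<close>: this is stationarity at a fixed
  mesh.\<close>

lemma expectation_block_hit:
  fixes h :: "(int ^ 'd) set \<Rightarrow> real"
  assumes "s > 0" "n > 0"
  shows "expectation (\<lambda>w. h (block_hit s n z (X w))) = (\<Sum>W\<in>Pow (block n).
    h W * hit_weight (measure lborel (grid_cell (s / real n) (0 :: int ^ 'd))) (block n) W)"
  unfolding block_hit_def
  by (rule expectation_hit[OF finite_block block_cell_borel_bounded[OF assms]
      disjoint_family_block_cells1 measure_grid_cell]) (use assms in auto)

text \<open>Both hit sets are sections of one hit set over \<open>{z, z'} \<times> block n\<close>,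
  whose weight factorises over the two layers.\<close>

lemma expectation_block_hit_mult:
  fixes h h' :: "(int ^ 'd) set \<Rightarrow> real"
  assumes "s > 0" "n > 0" "z \<noteq> z'"
  shows "expectation (\<lambda>w. h (block_hit s n z (X w)) * h' (block_hit s n z' (X w))) =
    expectation (\<lambda>w. h (block_hit s n z (X w))) * expectation (\<lambda>w. h' (block_hit s n z' (X w)))"
proof -
  let ?J = "block n :: (int ^ 'd) set"
  let ?I = "{z, z'} \<times> ?J"
  let ?C = "\<lambda>p. grid_cell (s / real n) (subindex n (fst p) (snd p))"
  let ?v = "measure lborel (grid_cell (s / real n) (0 :: int ^ 'd))"
  let ?P = "\<lambda>W W'. {z} \<times> W \<union> {z'} \<times> W'"
  have proj: "Pair y -` hit ?I ?C V = block_hit s n y V" if "y \<in> {z, z'}" for y V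
    using that by (auto simp: hit_def block_hit_def)
  have weight: "hit_weight ?v ?I (?P W W') = hit_weight ?v ?J W * hit_weight ?v ?J W'"
    if W: "W \<subseteq> ?J" "W' \<subseteq> ?J" for W W'
  proof -
    have card: "card (?P U U') = card U + card U'" if "U \<subseteq> ?J" "U' \<subseteq> ?J" for U U'
    proof -
      have "finite U" "finite U'"
        using that finite_block by (auto intro: finite_subset)
      then show ?thesis
        using \<open>z \<noteq> z'\<close> by (subst card_Un_disjoint) (auto simp: card_cartesian_product)
    qed
    \<comment> \<open>The unoccupied cells split over the layers as well, so both exponents in the
      weight add up.\<close>
    have "?I - ?P W W' = ?P (?J - W) (?J - W')"
      using \<open>z \<noteq> z'\<close> by auto
    then show ?thesis
      using W by (simp add: hit_weight_def card power_add)
  qed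
  have "expectation (\<lambda>w. h (block_hit s n z (X w)) * h' (block_hit s n z' (X w))) =
      expectation (\<lambda>w. (\<lambda>P. h (Pair z -` P) * h' (Pair z' -` P)) (hit ?I ?C (X w)))"
    using proj by simp
  also have "\<dots> = (\<Sum>P\<in>Pow ?I. (h (Pair z -` P) * h' (Pair z' -` P)) * hit_weight ?v ?I P)"
    by (rule expectation_hit[OF _ block_cell_borel_bounded[OF assms(1,2)]
        disjoint_family_block_cells measure_grid_cell]) (use assms in auto)
  \<comment> \<open>A subset of the two layers is the same as a pair of subsets, one per
    layer.\<close>
  also have "\<dots> = (\<Sum>(W, W')\<in>Pow ?J \<times> Pow ?J. (h W * h' W') * hit_weight ?v ?I (?P W W'))"
  proof (rule sum.reindex_bij_witness[where i = "\<lambda>(W, W'). ?P W W'" and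
        j = "\<lambda>P. (Pair z -` P, Pair z' -` P)"])
    fix P assume "P \<in> Pow ?I"
    then have P: "?P (Pair z -` P) (Pair z' -` P) = P"
      by auto
    then show "(case (Pair z -` P, Pair z' -` P) of (W, W') \<Rightarrow> ?P W W') = P"
      by simp
    show "(case (Pair z -` P, Pair z' -` P) of (W, W') \<Rightarrow> (h W * h' W') * hit_weight ?v ?I (?P W W')) =
        (h (Pair z -` P) * h' (Pair z' -` P)) * hit_weight ?v ?I P"
      using P by simp
  qed (use \<open>z \<noteq> z'\<close> in auto)
  also have "\<dots> = (\<Sum>(W, W')\<in>Pow ?J \<times> Pow ?J.
      (h W * hit_weight ?v ?J W) * (h' W' * hit_weight ?v ?J W'))"
    using weight by (intro sum.cong) auto
  also have "\<dots> = expectation (\<lambda>w. h (block_hit s n z (X w))) * expectation (\<lambda>w. h' (block_hit s n z' (X w)))"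
    unfolding expectation_block_hit[OF assms(1,2)] by (simp add: sum_product sum.cartesian_product)
  finally show ?thesis .
qed

section \<open>Moments of the cell counts in the limit of vanishing mesh\<close>

lemma integrable_max_colorable_power:
  assumes "lam > 0" "Q \<in> sets borel" "bounded Q" "p \<le> 2"
  shows "integrable M (\<lambda>w. real (max_colorable k 1 (X w \<inter> Q)) ^ p)"
proof (rule Bochner_Integration.integrable_bound)
  show "integrable M (\<lambda>w. real (card (X w \<inter> Q)) ^ p)"
    by (rule integrable_count_power[OF assms])
  show "(\<lambda>w. real (max_colorable k 1 (X w \<inter> Q)) ^ p) \<in> borel_measurable M"
    using borel_measurable_max_colorable[OF assms(2,3)] by (rule borel_measurable_power)
  show "AE w in M. norm (real (max_colorable k 1 (X w \<inter> Q)) ^ p) \<le> norm (real (card (X w \<inter> Q)) ^ p)"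
  proof (rule AE_I2)
    fix w assume "w \<in> space M"
    then have "max_colorable k 1 (X w \<inter> Q) \<le> card (X w \<inter> Q)"
      using locally_finite assms(3) by (intro max_colorable_le_card) blast
    then show "norm (real (max_colorable k 1 (X w \<inter> Q)) ^ p) \<le> norm (real (card (X w \<inter> Q)) ^ p)"
      by (simp add: power_mono)
  qed
qed

text \<open>Dominated convergence: the power of the number of points in the cell dominates for every
  mesh.\<close>

lemma block_value_power_LIMSEQ:
  fixes z :: "int ^ 'd"
  assumes "lam > 0" "s > 0" "p \<le> 2"
  shows "(\<lambda>n. expectation (\<lambda>w. real (block_value k s (Suc n) (block_hit s (Suc n) z (X w))) ^ p))
    \<longlonglongrightarrow> expectation (\<lambda>w. real (max_colorable k 1 (X w \<inter> grid_cell s z)) ^ p)"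
proof (rule integral_dominated_convergence)
  show "integrable M (\<lambda>w. real (card (X w \<inter> grid_cell s z)) ^ p)"
    by (rule integrable_count_power) (use assms in \<open>auto simp: bounded_grid_cell\<close>)
  show "(\<lambda>w. real (max_colorable k 1 (X w \<inter> grid_cell s z)) ^ p) \<in> borel_measurable M"
    by (intro borel_measurable_power borel_measurable_max_colorable bounded_grid_cell assms) measurable
  show "(\<lambda>w. real (block_value k s (Suc n) (block_hit s (Suc n) z (X w))) ^ p) \<in> borel_measurable M" for n
    by (rule borel_measurable_block_hit) (use assms in auto)
  have fin: "finite (X w \<inter> grid_cell s z)" if "w \<in> space M" for w
    using locally_finite[OF that] bounded_grid_cell[OF assms(2)] by blast
  show "AE w in M. (\<lambda>n. real (block_value k s (Suc n) (block_hit s (Suc n) z (X w))) ^ p)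
      \<longlonglongrightarrow> real (max_colorable k 1 (X w \<inter> grid_cell s z)) ^ p"
    using fin assms by (intro AE_I2 tendsto_power block_value_LIMSEQ) auto
  show "AE w in M. norm (real (block_value k s (Suc n) (block_hit s (Suc n) z (X w))) ^ p)
      \<le> real (card (X w \<inter> grid_cell s z)) ^ p" for n
  proof (rule AE_I2)
    fix w assume "w \<in> space M"
    then have "block_value k s (Suc n) (block_hit s (Suc n) z (X w)) \<le> card (X w \<inter> grid_cell s z)"
      by (intro block_value_le_card assms zero_less_Suc fin)
    then show "norm (real (block_value k s (Suc n) (block_hit s (Suc n) z (X w))) ^ p)
        \<le> real (card (X w \<inter> grid_cell s z)) ^ p"
      by (simp add: power_mono)
  qed
qed

text \<open>At each mesh the two expectations are the same finite sum, so their limits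
  coincide.\<close>

lemma expectation_cell_power_eq:
  fixes z z' :: "int ^ 'd"
  assumes "lam > 0" "s > 0" "p \<le> 2"
  shows "expectation (\<lambda>w. real (max_colorable k 1 (X w \<inter> grid_cell s z)) ^ p) =
    expectation (\<lambda>w. real (max_colorable k 1 (X w \<inter> grid_cell s z')) ^ p)"
  using block_value_power_LIMSEQ[OF assms, of k z] block_value_power_LIMSEQ[OF assms, of k z']
  unfolding expectation_block_hit[OF assms(2) zero_less_Suc, where h = "\<lambda>W. real (block_value k s (Suc _) W) ^ p"]
  by (rule LIMSEQ_unique)

text \<open>The exact factorisation at each mesh passes to the limit on both sides. The product is
  dominated by a sum of squared counts, hence the second moments.\<close>

lemma expectation_cell_mult:
  fixes z z' :: "int ^ 'd"
  assumes "lam > 0" "s > 0" "z \<noteq> z'"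
  shows "integrable M (\<lambda>w. real (max_colorable k 1 (X w \<inter> grid_cell s z)) *
      real (max_colorable k 1 (X w \<inter> grid_cell s z')))" (is ?int)
    and "expectation (\<lambda>w. real (max_colorable k 1 (X w \<inter> grid_cell s z)) *
      real (max_colorable k 1 (X w \<inter> grid_cell s z'))) =
    expectation (\<lambda>w. real (max_colorable k 1 (X w \<inter> grid_cell s z))) *
    expectation (\<lambda>w. real (max_colorable k 1 (X w \<inter> grid_cell s z')))" (is ?eq)
proof -
  let ?f = "\<lambda>z w. real (max_colorable k 1 (X w \<inter> grid_cell s z))"
  let ?g = "\<lambda>n z w. real (block_value k s (Suc n) (block_hit s (Suc n) z (X w)))"
  let ?N = "\<lambda>z w. real (card (X w \<inter> grid_cell s z))"
  have fin: "finite (X w \<inter> grid_cell s y)" if "w \<in> space M" for w y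
    using locally_finite[OF that] bounded_grid_cell[OF assms(2)] by blast
  have lim: "(\<lambda>n. expectation (?g n y)) \<longlonglongrightarrow> expectation (?f y)" for y
    using block_value_power_LIMSEQ[OF assms(1,2), of 1 k y] by simp
  have int: "integrable M (\<lambda>w. ?N z w ^ 2 + ?N z' w ^ 2)"
    by (intro Bochner_Integration.integrable_add integrable_count_power bounded_grid_cell assms grid_cell_borel) auto
  have meas: "(\<lambda>w. ?f z w * ?f z' w) \<in> borel_measurable M"
    by (intro borel_measurable_times borel_measurable_max_colorable bounded_grid_cell assms grid_cell_borel)
  have measg: "(\<lambda>w. ?g n z w * ?g n z' w) \<in> borel_measurable M" for n
    using borel_measurable_block_hit[OF assms(2) zero_less_Suc, where h = "\<lambda>W. real (block_value k s (Suc n) W)"]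
    by (intro borel_measurable_times)
  have limg: "AE w in M. (\<lambda>n. ?g n z w * ?g n z' w) \<longlonglongrightarrow> ?f z w * ?f z' w"
    using fin assms by (intro AE_I2 tendsto_mult block_value_LIMSEQ) auto
  have bound: "AE w in M. norm (?g n z w * ?g n z' w) \<le> ?N z w ^ 2 + ?N z' w ^ 2" for n
  proof (rule AE_I2)
    fix w assume "w \<in> space M"
    then have "?g n z w * ?g n z' w \<le> ?N z w * ?N z' w"
      using block_value_le_card[OF assms(2) zero_less_Suc fin] by (intro mult_mono) auto
    also have "\<dots> \<le> ?N z w ^ 2 + ?N z' w ^ 2"
      using sum_squares_bound[of "?N z w" "?N z' w"] mult_nonneg_nonneg[of "?N z w" "?N z' w"] by linarith
    finally show "norm (?g n z w * ?g n z' w) \<le> ?N z w ^ 2 + ?N z' w ^ 2"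
      by simp
  qed
  show ?int
    by (rule integrable_dominated_convergence[OF meas measg int limg bound])
  have "(\<lambda>n. expectation (\<lambda>w. ?g n z w * ?g n z' w)) \<longlonglongrightarrow> expectation (\<lambda>w. ?f z w * ?f z' w)"
    by (rule integral_dominated_convergence[OF meas measg int limg bound])
  moreover have "expectation (\<lambda>w. ?g n z w * ?g n z' w) = expectation (?g n z) * expectation (?g n z')" for n
    by (rule expectation_block_hit_mult[OF assms(2) zero_less_Suc assms(3)])
  ultimately have "(\<lambda>n. expectation (?g n z) * expectation (?g n z')) \<longlonglongrightarrow> expectation (\<lambda>w. ?f z w * ?f z' w)"
    by simp
  then show ?eq
    using tendsto_mult[OF lim lim] by (rule LIMSEQ_unique)
qed

end

section \<open>Convergence\<close>

text \<open>The extra 1 covers the last, partial layer of cells, and also the closed upper face when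
  \<open>t\<close> is a multiple of \<open>s\<close>, since cells are half-open.\<close>

lemma cube_subset_block_cells:
  assumes "s > 0"
  shows "cube t \<subseteq> (\<Union>z\<in>block (nat \<lfloor>t / s\<rfloor> + 1). grid_cell s z)"
proof
  fix x :: "real ^ 'd" assume "x \<in> cube t"
  then have x: "0 \<le> x $ i" "x $ i \<le> t" for i
    by (auto simp: cube_def)
  have "0 \<le> \<lfloor>x $ i / s\<rfloor> \<and> \<lfloor>x $ i / s\<rfloor> < int (nat \<lfloor>t / s\<rfloor> + 1)" for i
  proof -
    have "\<lfloor>x $ i / s\<rfloor> \<le> \<lfloor>t / s\<rfloor>"
      using x assms by (intro floor_mono divide_right_mono) auto
    moreover have "0 \<le> \<lfloor>x $ i / s\<rfloor>"
      using x[of i] assms by simp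
    ultimately show ?thesis
      by linarith
  qed
  then have "grid_index s x \<in> block (nat \<lfloor>t / s\<rfloor> + 1)"
    by (simp add: block_def grid_index_def)
  then show "x \<in> (\<Union>z\<in>block (nat \<lfloor>t / s\<rfloor> + 1). grid_cell s z)"
    by (auto simp: grid_cell_def)
qed

lemma cube_eq_cbox: "(cube t :: (real ^ 'd) set) = cbox 0 (\<chi> i. t)"
  by (auto simp: cube_def mem_box_cart)

lemma cube_borel: "(cube t :: (real ^ 'd) set) \<in> sets borel"
  and bounded_cube: "bounded (cube t :: (real ^ 'd) set)"
  unfolding cube_eq_cbox by simp_all

lemma grid_cell_0_subset_cube:
  assumes "s > 0"
  shows "grid_cell s 0 \<subseteq> cube s"
proof
  fix x :: "real ^ 'd" assume "x \<in> grid_cell s 0"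
  then show "x \<in> cube s"
    unfolding mem_grid_cell_iff[OF assms] by (auto simp: cube_def less_imp_le)
qed

context poisson_point_process
begin

section \<open>The normalised count, its mean and the sum of the cell counts\<close>

lemma F_tilde_eq:
  "F_tilde k lam X t = (\<lambda>w. real (max_colorable k 1 (X w \<inter> cube t)) / (lam * t ^ CARD('d)))"
  by (simp add: F_tilde_def F_count_def Int_commute fun_eq_iff)

lemma borel_measurable_F_tilde: "F_tilde k lam X t \<in> borel_measurable M"
  unfolding F_tilde_eq
  by (intro borel_measurable_divide borel_measurable_max_colorable cube_borel bounded_cube) auto

lemma integrable_F_tilde:
  assumes "lam > 0"
  shows "integrable M (F_tilde k lam X t)"
  unfolding F_tilde_eq
  using integrable_max_colorable_power[OF assms cube_borel bounded_cube, of 1] by simp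

lemma F_bar_nonneg:
  assumes "lam > 0" "t > 0"
  shows "F_bar M k lam X t \<ge> 0"
  unfolding F_bar_def F_tilde_eq using assms by (intro Bochner_Integration.integral_nonneg) auto

text \<open>The means are bounded below by 0, so the real infimum is a genuine lower bound.\<close>

lemma a_const_le_F_bar:
  assumes "lam > 0" "t > 0"
  shows "a_const M k lam X \<le> F_bar M k lam X t"
  unfolding a_const_def
  by (rule cINF_lower) (use F_bar_nonneg[OF assms(1)] assms in \<open>auto intro!: bdd_belowI2[where m = 0]\<close>)

text \<open>The cell at the origin represents all cells, by
  \<open>expectation_cell_power_eq\<close>.\<close>

definition cell_mean :: "nat \<Rightarrow> real \<Rightarrow> real" where
  "cell_mean k s = expectation (\<lambda>w. real (max_colorable k 1 (X w \<inter> grid_cell s 0)))"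

definition cell_variance :: "nat \<Rightarrow> real \<Rightarrow> real" where
  "cell_variance k s =
    expectation (\<lambda>w. (real (max_colorable k 1 (X w \<inter> grid_cell s 0)))\<^sup>2) - (cell_mean k s)\<^sup>2"

text \<open>The half-open cell lies in the closed cube. An inequality suffices because subadditivity
  is used for upper bounds.\<close>

lemma cell_mean_le:
  assumes "lam > 0" "s > 0"
  shows "cell_mean k s \<le> lam * s ^ CARD('d) * F_bar M k lam X s"
proof -
  have "cell_mean k s \<le> expectation (\<lambda>w. real (max_colorable k 1 (X w \<inter> cube s)))"
    unfolding cell_mean_def
  proof (rule integral_mono)
    show "integrable M (\<lambda>w. real (max_colorable k 1 (X w \<inter> grid_cell s 0)))"
      using integrable_max_colorable_power[OF assms(1) grid_cell_borel bounded_grid_cell[OF assms(2)], of 1]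
      by simp
    show "integrable M (\<lambda>w. real (max_colorable k 1 (X w \<inter> cube s)))"
      using integrable_max_colorable_power[OF assms(1) cube_borel bounded_cube, of 1] by simp
    fix w assume "w \<in> space M"
    then show "real (max_colorable k 1 (X w \<inter> grid_cell s 0)) \<le> real (max_colorable k 1 (X w \<inter> cube s))"
      using locally_finite[OF _ bounded_cube] grid_cell_0_subset_cube[OF assms(2)]
      by (intro of_nat_mono max_colorable_mono) auto
  qed
  also have "\<dots> = lam * s ^ CARD('d) * F_bar M k lam X s"
    unfolding F_bar_def F_tilde_eq using assms by simp
  finally show ?thesis .
qed

text \<open>The variance of a sum of pairwise uncorrelated variables with equal mean and variance:
  only the diagonal of the double sum survives.\<close>

lemma expectation_sum_cells_square:
  fixes k :: nat
  assumes "lam > 0" "s > 0" "finite Z"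
  defines "f \<equiv> \<lambda>z w. real (max_colorable k 1 (X w \<inter> grid_cell s z))"
  shows "integrable M (\<lambda>w. ((\<Sum>z\<in>Z. f z w) - real (card Z) * cell_mean k s)\<^sup>2)" (is ?int)
    and "expectation (\<lambda>w. ((\<Sum>z\<in>Z. f z w) - real (card Z) * cell_mean k s)\<^sup>2) =
      real (card Z) * cell_variance k s" (is ?eq)
proof -
  define \<mu> where "\<mu> = cell_mean k s"
  have int_pow: "integrable M (\<lambda>w. f z w ^ p)" if "p \<le> 2" for z p
    unfolding f_def by (intro integrable_max_colorable_power assms grid_cell_borel bounded_grid_cell that)
  have int1: "integrable M (f z)" for z
    using int_pow[of 1] by simp
  have mean: "expectation (f z) = \<mu>" for z
    using expectation_cell_power_eq[OF assms(1,2), of 1 k z 0] by (simp add: f_def \<mu>_def cell_mean_def)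
  have square: "expectation (\<lambda>w. (f z w)\<^sup>2) = cell_variance k s + \<mu>\<^sup>2" for z
    using expectation_cell_power_eq[OF assms(1,2), of 2 k z 0]
    by (simp add: f_def \<mu>_def cell_variance_def)
  have int2: "integrable M (\<lambda>w. f z w * f z' w)" for z z'
    using int_pow[of 2 z] expectation_cell_mult(1)[OF assms(1,2), of z z' k]
    by (cases "z = z'") (auto simp: power2_eq_square f_def)
  have prod: "expectation (\<lambda>w. f z w * f z' w) = \<mu>\<^sup>2 + (if z = z' then cell_variance k s else 0)" for z z'
    using square[of z] mean[of z] mean[of z'] expectation_cell_mult(2)[OF assms(1,2), of z z' k]
    by (auto simp: power2_eq_square f_def)
  have expand: "((\<Sum>z\<in>Z. f z w) - real (card Z) * cell_mean k s)\<^sup>2 =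
      (\<Sum>z\<in>Z. \<Sum>z'\<in>Z. f z w * f z' w - \<mu> * f z w - \<mu> * f z' w + \<mu>\<^sup>2)" for w
  proof -
    have "(\<Sum>z\<in>Z. f z w) - real (card Z) * cell_mean k s = (\<Sum>z\<in>Z. f z w - \<mu>)"
      by (simp add: sum_subtractf \<mu>_def)
    then have "((\<Sum>z\<in>Z. f z w) - real (card Z) * cell_mean k s)\<^sup>2 =
        (\<Sum>z\<in>Z. \<Sum>z'\<in>Z. (f z w - \<mu>) * (f z' w - \<mu>))"
      by (simp add: power2_eq_square sum_product)
    then show ?thesis
      by (simp add: algebra_simps power2_eq_square)
  qed
  have int: "integrable M (\<lambda>w. f z w * f z' w - \<mu> * f z w - \<mu> * f z' w + \<mu>\<^sup>2)" for z z'
    by (intro Bochner_Integration.integrable_add Bochner_Integration.integrable_diff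
        integrable_mult_right int1 int2) simp
  show ?int
    unfolding expand by (intro Bochner_Integration.integrable_sum int)
  have "expectation (\<lambda>w. f z w * f z' w - \<mu> * f z w - \<mu> * f z' w + \<mu>\<^sup>2) =
      (if z = z' then cell_variance k s else 0)" for z z'
    using int1 int2 by (simp add: prod mean prob_space power2_eq_square)
  then show ?eq
    unfolding expand using int assms(3)
    by (simp add: Bochner_Integration.integral_sum)
qed

text \<open>The order \<open>sqrt (card Z)\<close> is what matters: the volume normalising the count
  grows like \<open>card Z\<close>.\<close>

lemma expectation_abs_sum_cells_le:
  fixes k :: nat
  assumes "lam > 0" "s > 0" "finite Z" "Z \<noteq> {}"
  defines "f \<equiv> \<lambda>z w. real (max_colorable k 1 (X w \<inter> grid_cell s z))"
  shows "integrable M (\<lambda>w. \<bar>(\<Sum>z\<in>Z. f z w) - real (card Z) * cell_mean k s\<bar>)" (is ?int)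
    and "expectation (\<lambda>w. \<bar>(\<Sum>z\<in>Z. f z w) - real (card Z) * cell_mean k s\<bar>) \<le>
      (cell_variance k s + 1) / 2 * sqrt (real (card Z))" (is ?le)
proof -
  let ?Y = "\<lambda>w. (\<Sum>z\<in>Z. f z w) - real (card Z) * cell_mean k s"
  define c where "c = sqrt (real (card Z))"
  have c: "c > 0" "c * c = real (card Z)"
    using assms(3,4) by (auto simp: c_def card_gt_0_iff)
  have int: "integrable M (f z)" for z
    using integrable_max_colorable_power[OF assms(1) grid_cell_borel bounded_grid_cell[OF assms(2)], of 1]
    by (simp add: f_def)
  show ?int
    by (intro integrable_abs Bochner_Integration.integrable_diff Bochner_Integration.integrable_sum
        int integrable_const)
  \<comment> \<open>The inequality of arithmetic and geometric means;
    \<open>c = sqrt (card Z)\<close> balances the terms, as the mean square is \<open>card Z\<close>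
    times the cell variance.\<close>
  have "\<bar>y\<bar> \<le> (y\<^sup>2 / c + c) / 2" for y
  proof -
    have "2 * \<bar>y\<bar> * c \<le> y\<^sup>2 + c * c"
      using sum_squares_bound[of "\<bar>y\<bar>" c] by (simp add: power2_eq_square)
    then show ?thesis
      using c(1) by (simp add: field_simps)
  qed
  then have "expectation (\<lambda>w. \<bar>?Y w\<bar>) \<le> expectation (\<lambda>w. ((?Y w)\<^sup>2 / c + c) / 2)"
    using expectation_sum_cells_square(1)[OF assms(1-3), of k] \<open>?int\<close>
    by (intro integral_mono) (auto simp: f_def)
  also have "\<dots> = (expectation (\<lambda>w. (?Y w)\<^sup>2) / c + c) / 2"
    using expectation_sum_cells_square(1)[OF assms(1-3), of k] by (simp add: f_def prob_space)
  also have "\<dots> = (c * c * cell_variance k s / c + c) / 2"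
    using expectation_sum_cells_square(2)[OF assms(1-3), of k] c(2) by (simp add: f_def)
  also have "\<dots> = (cell_variance k s + 1) / 2 * c"
    using c(1) by (simp add: field_simps)
  finally show ?le
    unfolding c_def .
qed

text \<open>For a single cell the variance formula expresses it as the mean of a square.\<close>

lemma cell_variance_nonneg:
  assumes "lam > 0" "s > 0"
  shows "cell_variance k s \<ge> 0"
  using expectation_sum_cells_square(2)[OF assms, of "{0}" k]
    Bochner_Integration.integral_nonneg[of M "\<lambda>w. (real (max_colorable k 1 (X w \<inter> grid_cell s 0)) - cell_mean k s)\<^sup>2"]
  by simp

text \<open>Subadditivity bounds only the positive part of the deviation, but the mean of
  \<^term>\<open>F_tilde k lam X t\<close> is at least \<^term>\<open>a_const M k lam X\<close>, so the negative part is no larger in mean.\<close>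

lemma expectation_abs_F_tilde_le:
  fixes k :: nat
  assumes "lam > 0" "s > 0" "t > 0"
  defines "m \<equiv> nat \<lfloor>t / s\<rfloor> + 1"
  shows "expectation (\<lambda>w. \<bar>F_tilde k lam X t w - a_const M k lam X\<bar>) \<le>
    2 * ((cell_variance k s + 1) / 2 * (sqrt (real (m ^ CARD('d))) / (lam * t ^ CARD('d))) +
      ((real m * s / t) ^ CARD('d) * F_bar M k lam X s - a_const M k lam X))"
proof -
  let ?d = "CARD('d)" and ?a = "a_const M k lam X" and ?Z = "block m :: (int ^ 'd) set"
  let ?f = "\<lambda>z w. real (max_colorable k 1 (X w \<inter> grid_cell s z))"
  \<comment> \<open>\<open>D\<close> is the normalised fluctuation of the cell sum, \<open>B\<close>
    the deterministic excess over \<open>a_const M k lam X\<close> of the bound for its normalised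
    mean.\<close>
  define D where "D w = \<bar>(\<Sum>z\<in>?Z. ?f z w) - real (card ?Z) * cell_mean k s\<bar> / (lam * t ^ ?d)" for w
  define B where "B = (real m * s / t) ^ ?d * F_bar M k lam X s - ?a"
  have T: "lam * t ^ ?d > 0"
    using assms by simp
  have Z: "card ?Z = m ^ ?d" "?Z \<noteq> {}"
    using card_block[where 'd = 'd, of m] by (auto simp: m_def)
  \<comment> \<open>The cells cover an edge of length at least \<open>t\<close>; with
    \<open>F_bar M k lam X s\<close> at least the infimum this gives
    \<open>B \<ge> 0\<close>.\<close>
  have "t / s \<le> real m"
    using assms by (simp add: m_def) linarith
  then have "1 \<le> real m * s / t"
    using assms by (simp add: field_simps)
  then have "1 * F_bar M k lam X s \<le> (real m * s / t) ^ ?d * F_bar M k lam X s"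
    using F_bar_nonneg[OF assms(1,2)] by (intro mult_right_mono one_le_power)
  then have B: "B \<ge> 0"
    using a_const_le_F_bar[OF assms(1,2), of k] by (simp add: B_def)
  have D: "D w \<ge> 0" for w
    using T by (simp add: D_def)
  have intD: "integrable M D"
    using expectation_abs_sum_cells_le(1)[OF assms(1,2) finite_block Z(2), of k] by (simp add: D_def[abs_def])
  have le: "F_tilde k lam X t w - ?a \<le> D w + B" if w: "w \<in> space M" for w
  proof -
    have fin: "finite (X w \<inter> grid_cell s z)" for z
      using locally_finite[OF w bounded_grid_cell[OF assms(2)]] .
    have "X w \<inter> cube t \<subseteq> (\<Union>z\<in>?Z. X w \<inter> grid_cell s z)"
      using cube_subset_block_cells[OF assms(2), of t] by (auto simp: m_def)
    then have "max_colorable k 1 (X w \<inter> cube t) \<le> max_colorable k 1 (\<Union>z\<in>?Z. X w \<inter> grid_cell s z)"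
      using fin by (intro max_colorable_mono finite_UN_I finite_block)
    also have "\<dots> \<le> (\<Sum>z\<in>?Z. max_colorable k 1 (X w \<inter> grid_cell s z))"
      using fin by (intro max_colorable_UN_le) auto
    finally have "real (max_colorable k 1 (X w \<inter> cube t)) \<le> (\<Sum>z\<in>?Z. ?f z w)"
      unfolding of_nat_sum[symmetric] by (rule of_nat_mono)
    also have "\<dots> \<le> \<bar>(\<Sum>z\<in>?Z. ?f z w) - real (card ?Z) * cell_mean k s\<bar> + real (card ?Z) * cell_mean k s"
      by linarith
    also have "\<dots> \<le> \<bar>(\<Sum>z\<in>?Z. ?f z w) - real (card ?Z) * cell_mean k s\<bar> +
        real (card ?Z) * (lam * s ^ ?d * F_bar M k lam X s)"
      using cell_mean_le[OF assms(1,2), of k] by (intro add_left_mono mult_left_mono) auto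
    finally have "F_tilde k lam X t w \<le> (\<bar>(\<Sum>z\<in>?Z. ?f z w) - real (card ?Z) * cell_mean k s\<bar> +
        real (card ?Z) * (lam * s ^ ?d * F_bar M k lam X s)) / (lam * t ^ ?d)"
      unfolding F_tilde_eq using T by (intro divide_right_mono) auto
    also have "\<dots> = D w + (real m * s / t) ^ ?d * F_bar M k lam X s"
      unfolding D_def Z(1) using assms(1-3)
      by (simp add: add_divide_distrib power_mult_distrib power_divide)
    finally show ?thesis
      by (simp add: B_def)
  qed
  \<comment> \<open>If \<open>y \<le> b\<close> and \<open>b \<ge> 0\<close>, then
    \<open>\<bar>y\<bar> \<le> 2 * b - y\<close>; here \<open>y\<close> is the deviation and
    \<open>b\<close> is \<open>D w + B\<close>.\<close>
  have "expectation (\<lambda>w. \<bar>F_tilde k lam X t w - ?a\<bar>) \<le>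
      expectation (\<lambda>w. 2 * (D w + B) - (F_tilde k lam X t w - ?a))"
  proof (rule integral_mono)
    show "\<bar>F_tilde k lam X t w - ?a\<bar> \<le> 2 * (D w + B) - (F_tilde k lam X t w - ?a)"
      if "w \<in> space M" for w
      using le[OF that] D[of w] B by (simp add: abs_le_iff)
  qed (use integrable_F_tilde[OF assms(1), of k t] intD in auto)
  also have "\<dots> = 2 * (expectation D + B) - (F_bar M k lam X t - ?a)"
    using integrable_F_tilde[OF assms(1), of k t] intD by (simp add: F_bar_def prob_space)
  also have "\<dots> \<le> 2 * (expectation D + B)"
    using a_const_le_F_bar[OF assms(1,3), of k] by simp
  also have "\<dots> \<le> 2 * ((cell_variance k s + 1) / 2 * (sqrt (real (card ?Z)) / (lam * t ^ ?d)) + B)"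
    using expectation_abs_sum_cells_le(2)[OF assms(1,2) finite_block Z(2), of k] T
    by (simp add: D_def[abs_def] divide_right_mono)
  finally show ?thesis
    by (simp add: B_def Z(1))
qed

text \<open>The side \<open>s\<close> is fixed first, with mean close to the infimum; then
  \<open>t\<close> grows. The fluctuation vanishes and the boundary excess of the tiling
  disappears.\<close>

lemma F_tilde_L1_tendsto:
  assumes "lam > 0"
  shows "((\<lambda>t. expectation (\<lambda>w. \<bar>F_tilde k lam X t w - a_const M k lam X\<bar>)) \<longlongrightarrow> 0) at_top"
proof (rule tendstoI)
  fix e :: real assume e: "e > 0"
  let ?d = "CARD('d)" and ?a = "a_const M k lam X"
  have "?a < ?a + e / 2"
    using e by simp
  moreover have "bdd_below (F_bar M k lam X ` {0<..})"
    using F_bar_nonneg[OF assms] by (intro bdd_belowI2[where m = 0]) auto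
  \<comment> \<open>The margin \<open>e / 2\<close> compensates the factor 2 in the L1
    bound.\<close>
  ultimately obtain s where s: "s > 0" "F_bar M k lam X s < ?a + e / 2"
    unfolding a_const_def by (subst (asm) cINF_less_iff) auto
  define v where "v = cell_variance k s"
  \<comment> \<open>\<open>h t * t = t / s + 1\<close> bounds the number of cells along an edge,
    replacing the floor by an expression with a limit.\<close>
  define h where "h t = 1 / s + 1 / t" for t :: real
  define R where "R t = 2 * ((v + 1) / 2 * (sqrt (h t ^ ?d) / lam * (1 / sqrt (t ^ ?d))) +
      ((h t * s) ^ ?d * F_bar M k lam X s - ?a))" for t
  have h: "(h \<longlongrightarrow> 1 / s + 0) at_top"
    unfolding h_def[abs_def] by (intro tendsto_add tendsto_const tendsto_divide_0[OF tendsto_const] filterlim_at_top_imp_at_infinity filterlim_ident)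
  have q: "((\<lambda>t. 1 / sqrt (t ^ ?d)) \<longlongrightarrow> 0) at_top"
    by (intro tendsto_divide_0[OF tendsto_const] filterlim_at_top_imp_at_infinity
        filterlim_compose[OF sqrt_at_top] filterlim_pow_at_top filterlim_ident) simp
  have "(R \<longlongrightarrow> 2 * ((v + 1) / 2 * (sqrt ((1 / s + 0) ^ ?d) / lam * 0) +
      (((1 / s + 0) * s) ^ ?d * F_bar M k lam X s - ?a))) at_top"
    unfolding R_def[abs_def] by (intro tendsto_intros h q) (use assms in auto)
  then have "(R \<longlongrightarrow> 2 * (F_bar M k lam X s - ?a)) at_top"
    using s by simp
  moreover have "2 * (F_bar M k lam X s - ?a) < e"
    using s by simp
  ultimately have "\<forall>\<^sub>F t in at_top. R t < e"
    by (rule order_tendstoD(2))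
  then show "\<forall>\<^sub>F t in at_top. dist (expectation (\<lambda>w. \<bar>F_tilde k lam X t w - ?a\<bar>)) 0 < e"
    using eventually_gt_at_top[of 0]
  proof eventually_elim
    case (elim t)
    let ?m = "nat \<lfloor>t / s\<rfloor> + 1"
    have "real ?m \<le> t / s + 1"
      using elim s by simp
    also have "\<dots> = h t * t"
      using elim by (simp add: h_def field_simps)
    finally have m: "real ?m \<le> h t * t" .
    have "sqrt (real (?m ^ ?d)) / (lam * t ^ ?d) \<le> sqrt ((h t * t) ^ ?d) / (lam * t ^ ?d)"
      using m elim assms unfolding of_nat_power
      by (intro divide_right_mono real_sqrt_le_mono power_mono) auto
    \<comment> \<open>Writing the volume as the square of its root leaves one factor
      \<open>1 / sqrt (t ^ ?d)\<close>, the rate of decay of the fluctuation.\<close>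
    also have "\<dots> = sqrt (h t ^ ?d) / lam * (sqrt (t ^ ?d) / (sqrt (t ^ ?d) * sqrt (t ^ ?d)))"
      using elim by (simp add: power_mult_distrib real_sqrt_mult)
    also have "\<dots> = sqrt (h t ^ ?d) / lam * (1 / sqrt (t ^ ?d))"
      using elim by (simp del: real_sqrt_mult_self)
    finally have 1: "(v + 1) / 2 * (sqrt (real (?m ^ ?d)) / (lam * t ^ ?d)) \<le>
        (v + 1) / 2 * (sqrt (h t ^ ?d) / lam * (1 / sqrt (t ^ ?d)))"
      using cell_variance_nonneg[OF assms s(1), of k] by (intro mult_left_mono) (auto simp: v_def)
    have "real ?m * s / t \<le> h t * t * s / t"
      using m elim s by (intro divide_right_mono mult_right_mono) auto
    also have "\<dots> = h t * s"
      using elim by simp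
    finally have "(real ?m * s / t) ^ ?d \<le> (h t * s) ^ ?d"
      using elim s by (intro power_mono) auto
    then have 2: "(real ?m * s / t) ^ ?d * F_bar M k lam X s \<le> (h t * s) ^ ?d * F_bar M k lam X s"
      using F_bar_nonneg[OF assms s(1)] by (rule mult_right_mono)
    note expectation_abs_F_tilde_le[OF assms s(1) elim(2), of k, folded v_def]
    also have "2 * ((v + 1) / 2 * (sqrt (real (?m ^ ?d)) / (lam * t ^ ?d)) +
        ((real ?m * s / t) ^ ?d * F_bar M k lam X s - ?a)) \<le> R t"
      unfolding R_def by (intro mult_left_mono add_mono diff_right_mono 1 2) simp
    finally have "expectation (\<lambda>w. \<bar>F_tilde k lam X t w - ?a\<bar>) \<le> R t" .
    moreover have "expectation (\<lambda>w. \<bar>F_tilde k lam X t w - ?a\<bar>) \<ge> 0"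
      by (intro Bochner_Integration.integral_nonneg) simp
    ultimately show ?case
      using elim by simp
  qed
qed

text \<open>Markov's inequality turns L1 convergence into convergence in probability; the strict
  event is contained in the non-strict one it bounds.\<close>

lemma F_tilde_converges_in_prob:
  assumes "lam > 0"
  shows "converges_in_prob_at_top M (F_tilde k lam X) (a_const M k lam X)"
  unfolding converges_in_prob_at_top_def
proof (intro conjI allI impI)
  show "F_tilde k lam X t \<in> borel_measurable M" for t
    by (rule borel_measurable_F_tilde)
  fix \<epsilon> :: real assume \<epsilon>: "\<epsilon> > 0"
  let ?Y = "\<lambda>t w. \<bar>F_tilde k lam X t w - a_const M k lam X\<bar>"
  have "prob {w \<in> space M. ?Y t w > \<epsilon>} \<le> expectation (?Y t) / \<epsilon>" for t
  proof -
    have [measurable]: "F_tilde k lam X t \<in> borel_measurable M"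
      by (rule borel_measurable_F_tilde)
    have int: "integrable M (?Y t)"
      by (intro integrable_abs Bochner_Integration.integrable_diff integrable_F_tilde assms integrable_const)
    have "{w \<in> space M. ?Y t w \<ge> \<epsilon>} \<in> events"
      by measurable
    then have "prob {w \<in> space M. ?Y t w > \<epsilon>} \<le> prob {w \<in> space M. ?Y t w \<ge> \<epsilon>}"
      by (rule finite_measure_mono[rotated]) auto
    also have "\<dots> \<le> expectation (?Y t) / \<epsilon>"
      by (rule integral_Markov_inequality_measure[where A = "{}", OF int]) (use \<epsilon> in auto)
    finally show ?thesis .
  qed
  then have le: "\<forall>\<^sub>F t in at_top. prob {w \<in> space M. ?Y t w > \<epsilon>} \<le> expectation (?Y t) / \<epsilon>"
    by (intro always_eventually allI)
  have "((\<lambda>t. expectation (?Y t) / \<epsilon>) \<longlongrightarrow> 0 / \<epsilon>) at_top"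
    using \<epsilon> by (intro tendsto_divide F_tilde_L1_tendsto assms tendsto_const) auto
  then have lim: "((\<lambda>t. expectation (?Y t) / \<epsilon>) \<longlongrightarrow> 0) at_top"
    by simp
  show "((\<lambda>t. prob {w \<in> space M. ?Y t w > \<epsilon>}) \<longlongrightarrow> 0) at_top"
    by (rule tendsto_sandwich[OF _ le tendsto_const lim]) simp
qed

end

theorem proposition9:
  fixes M :: "'w measure" and X :: "'w \<Rightarrow> (real ^ 'd) set" and k :: nat and lam :: real
  assumes "k \<ge> 1" and "lam > 0"
    and "poisson_point_process M lam X"
  shows "converges_in_prob_at_top M (F_tilde k lam X) (a_const M k lam X)"
  by (rule poisson_point_process.F_tilde_converges_in_prob[OF assms(3,2)])

end
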